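(* Let $\ell \geq 1$ and $k\geq 9\ell^2 - 3\ell +1$ be integers. Let $G$ be a minor-minimal $2$-connected graph containing a subdivision of $\Gamma_k$, and let $T^1$ be a full binary tree of height at most $3\ell-2$. Then either $G$ contains $\Gamma_{\ell}^{+}$ as a minor, or $G$ contains a clean binary pear tree $(T^1, \mathcal{B})$.
   Context: All graphs are finite and simple. $\Gamma_m$ is the complete binary tree of height $m$ (rooted; every non-leaf vertex has two children; every root-to-leaf path has $m$ edges); $\Gamma_\ell^+$ is obtained from $\Gamma_\ell$ by adding a new vertex adjacent to all its leaves. "$G$ is a minor-minimal $2$-connected graph containing a subdivision of $\Gamma_k$" means $G$ is $2$-connected, contains a subdivision of $\Gamma_k$ as a subgraph, and no proper minor of $G$ is $2$-connected and contains a subdivision of $\Gamma_k$. A binary tree is a rooted tree in which every vertex has at most two children; it is full if every non-leaf vertex has exactly two children; $T_x$ is the subtree rooted at $x$. The length of a path is its number of edges; for a subgraph $H$, an $H$-ear is a path with both ends in $V(H)$ and no internal vertex in $V(H)$. A binary pear tree in $G$ is a pair $(T,\mathcal{B})$ with $T$ a binary tree and $\mathcal{B}=\{(P_x,Q_x):x\in V(T)\}$ pairs of paths in $G$ of length at least $2$ with $P_x\subseteq Q_x$, such that for every non-root $x$ with parent $y$: (1) $Q_x$ is a $P_y$-ear; (2) if $x$ has no sibling, no internal vertex of $Q_x$ lies in $\bigcup_{z\in V(T)\setminus V(T_x)}V(Q_z)$; (3) if $x$ has a sibling $x'$, then no internal vertex of $Q_x$ lies in $\bigcup_{z\in V(T)\setminus(V(T_x)\cup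 V(T_{x'}))}V(Q_z)$, and no internal vertex of $P_x$ lies in $Q_{x'}$. It is clean if for every non-leaf $y$ of $T$ some end of $P_y$ is not contained in any $Q_x$ with $x$ a child of $y$. *)

theory Defs
  imports "Graph_Theory.Graph_Theory"
begin

text \<open>
  A finite simple graph is a \<^locale>\<open>pair_graph\<close>: a finite vertex set together with a finite,
  symmetric, irreflexive set of arcs, each edge being the two arcs between its ends.
\<close>


subsection \<open>Connectivity, minors and subdivisions\<close>

text \<open>\<^const>\<open>connected\<close> excludes the graph without vertices.\<close>

definition two_connected :: "'a pair_pre_digraph \<Rightarrow> bool" where
  "two_connected G \<longleftrightarrow> pair_graph G \<and> 3 \<le> card (pverts G) \<and> connected (with_proj G) \<and>
     (\<forall>v \<in> pverts G. connected (with_proj G \<restriction> (pverts G - {v})))"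

text \<open>
  \<open>H\<close> is a minor of \<open>G\<close>: there are non-empty, pairwise disjoint, connected branch sets \<open>\<mu> v\<close>
  in \<open>G\<close>, one for each vertex of \<open>H\<close>, and every edge of \<open>H\<close> is realised by an edge of \<open>G\<close>
  between the corresponding branch sets.
\<close>

definition minor_of :: "'b pair_pre_digraph \<Rightarrow> 'a pair_pre_digraph \<Rightarrow> bool" where
  "minor_of H G \<longleftrightarrow> pair_graph H \<and> pair_graph G \<and>
     (\<exists>\<mu> :: 'b \<Rightarrow> 'a set.
        (\<forall>v \<in> pverts H. \<mu> v \<subseteq> pverts G \<and> connected (with_proj G \<restriction> \<mu> v)) \<and>
        (\<forall>u \<in> pverts H. \<forall>v \<in> pverts H. u \<noteq> v \<longrightarrow> \<mu> u \<inter> \<mu> v = {}) \<and>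
        (\<forall>(u, v) \<in> parcs H. \<exists>a \<in> \<mu> u. \<exists>b \<in> \<mu> v. (a, b) \<in> parcs G))"

definition proper_minor_of :: "'b pair_pre_digraph \<Rightarrow> 'a pair_pre_digraph \<Rightarrow> bool" where
  "proper_minor_of H G \<longleftrightarrow> minor_of H G \<and> \<not> digraph_iso (with_proj H) (with_proj G)"

text \<open>
  \<^const>\<open>subdivision\<close> keeps the names of the original vertices, so \<open>F\<close> is first replaced by an
  isomorphic copy \<open>K\<close> whose vertices are the branch vertices in \<open>G\<close>.
\<close>

definition contains_subdivision :: "'a pair_pre_digraph \<Rightarrow> 'b pair_pre_digraph \<Rightarrow> bool" where
  "contains_subdivision G F \<longleftrightarrow>
     (\<exists>K H :: 'a pair_pre_digraph. digraph_iso (with_proj F) (with_proj K) \<and>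
        subdivision_pair K H \<and> subgraph (with_proj H) (with_proj G))"


subsection \<open>The graphs \<open>\<Gamma>\<^sub>m\<close> and \<open>\<Gamma>\<^sub>m\<^sup>+\<close>\<close>

text \<open>
  The vertices of \<open>\<Gamma>\<^sub>m\<close> are the bit strings of length at most \<open>m\<close>. The root is the empty string
  and the children of \<open>w\<close> are \<open>True # w\<close> and \<open>False # w\<close>.
\<close>

definition Gamma :: "nat \<Rightarrow> bool list pair_pre_digraph" where
  "Gamma m = \<lparr> pverts = {w. length w \<le> m},
     parcs = {(w, b # w) | w b. length w < m} \<union> {(b # w, w) | w b. length w < m} \<rparr>"

text \<open>The added vertex is \<^const>\<open>None\<close>.\<close>

definition Gamma_plus :: "nat \<Rightarrow> bool list option pair_pre_digraph" where
  "Gamma_plus m = \<lparr> pverts = insert None (Some ` pverts (Gamma m)),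
     parcs = {(Some u, Some v) | u v. (u, v) \<in> parcs (Gamma m)} \<union>
       {(Some w, None) | w. length w = m} \<union> {(None, Some w) | w. length w = m} \<rparr>"

lemma pair_graph_Gamma: "pair_graph (Gamma m)"
proof -
  have fin: "finite {w :: bool list. length w \<le> m}"
    using finite_lists_length_le[of "UNIV :: bool set" m] by simp
  have "parcs (Gamma m) \<subseteq> {w. length w \<le> m} \<times> {w. length w \<le> m}"
    by (auto simp: Gamma_def)
  then have "finite (parcs (Gamma m))"
    by (rule finite_subset) (use fin in simp)
  with fin show ?thesis
    by unfold_locales (auto simp: Gamma_def symmetric_def sym_def)
qed

lemma pair_graph_Gamma_plus: "pair_graph (Gamma_plus m)"
proof -
  interpret g: pair_graph "Gamma m" by (rule pair_graph_Gamma)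
  have fin: "finite (pverts (Gamma_plus m))"
    using g.pair_finite_verts by (simp add: Gamma_plus_def)
  have sub: "parcs (Gamma_plus m) \<subseteq> pverts (Gamma_plus m) \<times> pverts (Gamma_plus m)"
    by (auto simp: Gamma_plus_def Gamma_def)
  then have "finite (parcs (Gamma_plus m))"
    by (rule finite_subset) (use fin in simp)
  with fin sub show ?thesis
    by unfold_locales (auto simp: Gamma_plus_def Gamma_def symmetric_def sym_def)
qed

text \<open>
  Proper minors of \<open>G\<close> are taken up to isomorphism, and each has a copy on vertices of \<open>G\<close>, so
  nothing is lost by letting \<open>H\<close> range over graphs on the vertex type of \<open>G\<close>.
\<close>

definition minor_minimal_2conn_subdiv_Gamma :: "nat \<Rightarrow> 'a pair_pre_digraph \<Rightarrow> bool" where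
  "minor_minimal_2conn_subdiv_Gamma k G \<longleftrightarrow>
     two_connected G \<and> contains_subdivision G (Gamma k) \<and>
     (\<forall>H :: 'a pair_pre_digraph. proper_minor_of H G \<longrightarrow>
        \<not> (two_connected H \<and> contains_subdivision H (Gamma k)))"


subsection \<open>Rooted trees\<close>

text \<open>
  A finite rooted tree is given by its orientation away from the root \<open>r\<close>: the arcs are the pairs
  (parent, child), and from \<open>r\<close> there is exactly one walk to each vertex.
\<close>

definition rooted_tree :: "'t pair_pre_digraph \<Rightarrow> 't \<Rightarrow> bool" where
  "rooted_tree T r \<longleftrightarrow> pair_digraph T \<and> r \<in> pverts T \<and>
     (\<forall>v \<in> pverts T. \<exists>!p. pre_digraph.awalk (with_proj T) r p v)"

definition children :: "'t pair_pre_digraph \<Rightarrow> 't \<Rightarrow> 't set" where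
  "children T x = {y. (x, y) \<in> parcs T}"

definition leaf :: "'t pair_pre_digraph \<Rightarrow> 't \<Rightarrow> bool" where
  "leaf T x \<longleftrightarrow> x \<in> pverts T \<and> children T x = {}"

definition subtree_verts :: "'t pair_pre_digraph \<Rightarrow> 't \<Rightarrow> 't set" where
  "subtree_verts T x = {z. x \<rightarrow>\<^sup>*\<^bsub>with_proj T\<^esub> z}"

definition tree_height :: "'t pair_pre_digraph \<Rightarrow> 't \<Rightarrow> nat" where
  "tree_height T r = Max {length p | p v. leaf T v \<and> pre_digraph.awalk (with_proj T) r p v}"

definition binary_tree :: "'t pair_pre_digraph \<Rightarrow> 't \<Rightarrow> bool" where
  "binary_tree T r \<longleftrightarrow> rooted_tree T r \<and> (\<forall>x \<in> pverts T. card (children T x) \<le> 2)"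

definition full_binary_tree :: "'t pair_pre_digraph \<Rightarrow> 't \<Rightarrow> bool" where
  "full_binary_tree T r \<longleftrightarrow> binary_tree T r \<and>
     (\<forall>x \<in> pverts T. \<not> leaf T x \<longrightarrow> card (children T x) = 2)"


subsection \<open>Binary pear trees\<close>

text \<open>
  A path in \<open>G\<close> is a vertex list \<open>p\<close> with \<^prop>\<open>vpath p (with_proj G)\<close>; the lists \<open>p\<close> and \<open>rev p\<close>
  stand for the same path, and all notions below are invariant under reversal.
\<close>

definition path_graph :: "'a list \<Rightarrow> 'a pair_pre_digraph" where
  "path_graph p = \<lparr> pverts = set p, parcs = set (vwalk_arcs p) \<union> (set (vwalk_arcs p))\<inverse> \<rparr>"

definition path_ends :: "'a list \<Rightarrow> 'a set" where
  "path_ends p = {hd p, last p}"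

definition internal_verts :: "'a list \<Rightarrow> 'a set" where
  "internal_verts p = set p - path_ends p"

text \<open>An ear of a subgraph with vertex set \<open>S\<close>.\<close>

definition ear :: "'a pair_pre_digraph \<Rightarrow> 'a set \<Rightarrow> 'a list \<Rightarrow> bool" where
  "ear G S q \<longleftrightarrow> vpath q (with_proj G) \<and> path_ends q \<subseteq> S \<and> internal_verts q \<inter> S = {}"

definition binary_pear_tree ::
  "'a pair_pre_digraph \<Rightarrow> 't pair_pre_digraph \<Rightarrow> 't \<Rightarrow> ('t \<Rightarrow> 'a list) \<Rightarrow> ('t \<Rightarrow> 'a list) \<Rightarrow> bool"
where
  "binary_pear_tree G T r P Q \<longleftrightarrow>
     binary_tree T r \<and>
     (\<forall>x \<in> pverts T.
        vpath (P x) (with_proj G) \<and> vpath (Q x) (with_proj G) \<and>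
        2 \<le> vwalk_length (P x) \<and> 2 \<le> vwalk_length (Q x) \<and>
        subgraph (with_proj (path_graph (P x))) (with_proj (path_graph (Q x)))) \<and>
     (\<forall>(y, x) \<in> parcs T.
        ear G (set (P y)) (Q x) \<and>
        (children T y = {x} \<longrightarrow>
           internal_verts (Q x) \<inter> (\<Union>z \<in> pverts T - subtree_verts T x. set (Q z)) = {}) \<and>
        (\<forall>x' \<in> children T y. x' \<noteq> x \<longrightarrow>
           internal_verts (Q x) \<inter>
             (\<Union>z \<in> pverts T - (subtree_verts T x \<union> subtree_verts T x'). set (Q z)) = {} \<and>
           internal_verts (P x) \<inter> set (Q x') = {}))"

definition clean_binary_pear_tree ::
  "'a pair_pre_digraph \<Rightarrow> 't pair_pre_digraph \<Rightarrow> 't \<Rightarrow> ('t \<Rightarrow> 'a list) \<Rightarrow> ('t \<Rightarrow> 'a list) \<Rightarrow> bool"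
where
  "clean_binary_pear_tree G T r P Q \<longleftrightarrow> binary_pear_tree G T r P Q \<and>
     (\<forall>y \<in> pverts T. \<not> leaf T y \<longrightarrow>
        (\<exists>e \<in> path_ends (P y). \<forall>x \<in> children T y. e \<notin> set (Q x)))"

end

theory Submission
  imports Defs
begin

text \<open>
  By minimality the subdivision \<open>T\<close> of \<open>\<Gamma>\<^sub>k\<close> spans \<open>G\<close>: an edge with an end outside \<open>T\<close> could be
  contracted or deleted. Write \<open>T\<^sub>b\<close> for the subtree below \<open>b\<close>. If all subtrees rooted \<open>l\<close> levels
  below \<open>b\<close> had an edge leaving \<open>T\<^sub>b\<close>, then contracting the complement of \<open>T\<^sub>b\<close> would give
  \<open>\<Gamma>\<^sub>l\<^sup>+\<close>. Hence, without this minor, some vertex at most \<open>l\<close> levels below \<open>b\<close> has a subtree whose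
  edges all stay in \<open>T\<^sub>b\<close> and the parent of \<open>b\<close>.

  A node \<open>x\<close> of the pear tree receives a vertex \<open>a\<close> with parent \<open>p\<close>, and its path \<open>P\<^sub>x\<close> runs from
  \<open>p\<close> down into \<open>T\<^sub>a\<close> and out again along one edge. The end outside \<open>T\<^sub>a\<close> witnesses cleanness,
  since all ears below \<open>x\<close> stay in \<open>T\<^sub>a\<close> and \<open>p\<close>. A subtree \<open>D\<close> hanging off \<open>P\<^sub>x\<close> without edges
  leaving \<open>T\<^sub>a\<close> and \<open>p\<close> contains, below its first branching, one such vertex \<open>a\<^sub>i\<close> for each child, and
  Menger's theorem for two paths closes the path of each child to an ear of \<open>P\<^sub>x\<close> that avoids
  the subtree reserved for the other child. This costs \<open>2l + 1\<close> levels of \<open>T\<close> per level of \<open>T\<^sup>1\<close>.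
\<close>

section \<open>Paths\<close>

text \<open>Sibling ears may cross, but neither may touch the inside of the other's path. Each ear
  is therefore sought on its own, in the subtree of \<open>a\<close> and its parent, with both
  reserved subtrees taken out. This could destroy the connectivity that Menger's theorem needs, and
  the choice of \<open>a1\<close> prevents it. Let \<open>b1\<close> be the child, above
  \<open>a1\<close>, of the branching vertex \<open>f\<close>, and \<open>t1\<close> the far end of
  the child's path. Below the parent \<open>p1\<close> of \<open>a1\<close> there is still an edge
  leaving the subtree of \<open>b1\<close> other than to \<open>f\<close>, below \<open>a1\<close>
  there is none, and every sibling of \<open>a1\<close> has an edge leaving the subtree of
  \<open>p1\<close>. A vertex cutting \<open>p1\<close> and \<open>t1\<close> off from the path of
  the current node is refuted by one of these edges or, if it lies at or above \<open>f\<close>, by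
  2-connectivity of \<open>G\<close>. Of the \<open>2 * l + 1\<close> levels, \<open>l\<close> lead
  to a subtree whose edges stay near \<open>a\<close>, one is its branching, and \<open>l\<close>
  more lead to \<open>a1\<close> and \<open>a2\<close>. Two further levels at the top keep the
  parent of the first \<open>a\<close> away from the root of the subdivision: the root is the
  outside vertex that must stay reachable when a parent is deleted.\<close>

definition is_path :: "('a \<times> 'a) set \<Rightarrow> 'a \<Rightarrow> 'a list \<Rightarrow> 'a \<Rightarrow> bool" where
  "is_path E x p y \<longleftrightarrow> p \<noteq> [] \<and> hd p = x \<and> last p = y \<and> distinct p \<and> set (vwalk_arcs p) \<subseteq> E"

lemma set_vwalk_arcs_append:
  "set (vwalk_arcs (p @ q)) =
     set (vwalk_arcs p) \<union> set (vwalk_arcs q) \<union> (if p = [] \<or> q = [] then {} else {(last p, hd q)})"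
  by (cases "p = []"; cases "q = []") (auto simp: vwalk_arcs_append)

lemma set_vwalk_arcs_rev: "set (vwalk_arcs (rev p)) = (set (vwalk_arcs p))\<inverse>"
proof (induction p)
  case (Cons a p)
  then show ?case
    by (cases "p = []") (auto simp: set_vwalk_arcs_append last_rev)
qed simp

lemma split_list_first_in:
  assumes "set N \<inter> X \<noteq> {}"
  obtains N1 z N2 where "N = N1 @ z # N2" "z \<in> X" "set N1 \<inter> X = {}"
  using split_list_first_prop[of N "\<lambda>u. u \<in> X"] assms by (metis disjoint_iff)

lemma split_list_last_in:
  assumes "set N \<inter> X \<noteq> {}"
  obtains N1 z N2 where "N = N1 @ z # N2" "z \<in> X" "set N2 \<inter> X = {}"
  using split_list_last_prop[of N "\<lambda>u. u \<in> X"] assms by (metis disjoint_iff)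

lemma is_path_singleton: "is_path E x [x] x"
  by (simp add: is_path_def)

lemma is_path_split:
  assumes "is_path E x (p @ z # q) y"
  shows "is_path E x (p @ [z]) z" "is_path E z (z # q) y"
  using assms by (auto simp: is_path_def set_vwalk_arcs_append hd_append split: if_splits)

lemma is_path_join:
  assumes "is_path E x (p @ [z]) z" "is_path E z (z # q) y" "set p \<inter> set q = {}"
  shows "is_path E x (p @ z # q) y"
  using assms by (cases q) (auto simp: is_path_def set_vwalk_arcs_append hd_append split: if_splits)

lemma is_path_snoc:
  assumes "is_path E x p y" "(y, z) \<in> E" "z \<notin> set p"
  shows "is_path E x (p @ [z]) z"
  using assms by (auto simp: is_path_def set_vwalk_arcs_append)

lemma is_path_rev:
  assumes "is_path E x p y" "sym E"
  shows "is_path E y (rev p) x"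
  using assms by (auto simp: is_path_def set_vwalk_arcs_rev hd_rev last_rev sym_def)

lemma set_path_subset:
  assumes "set (vwalk_arcs p) \<subseteq> H \<times> H" "p \<noteq> []" "hd p \<in> H"
  shows "set p \<subseteq> H"
  using assms by (induction p rule: vwalk_arcs.induct) auto

lemma rtrancl_imp_is_path:
  assumes "(x, y) \<in> E\<^sup>*"
  obtains p where "is_path E x p y"
proof -
  from assms have "\<exists>p. is_path E x p y"
  proof (induction rule: rtrancl_induct)
    case base
    show ?case using is_path_singleton by fast
  next
    case (step y z)
    then obtain p where p: "is_path E x p y" by blast
    show ?case
    proof (cases "z \<in> set p")
      case True
      then obtain p1 p2 where "p = p1 @ z # p2" by (meson split_list)
      with p show ?thesis using is_path_split(1) by metis
    next
      case False
      with p step show ?thesis using is_path_snoc by metis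
    qed
  qed
  then show ?thesis using that by blast
qed

text \<open>
  Menger's theorem for two paths: the invariant is that some \<open>A\<close>-\<open>v\<close> path is disjoint from some
  \<open>A\<close>-\<open>B\<close> path; it is propagated along the arcs, and the claim is its instance for \<open>v \<in> B\<close>.
\<close>

lemma two_disjoint_paths:
  assumes nosep: "\<And>w. \<exists>x\<in>A. \<exists>y\<in>B. \<exists>p. is_path E x p y \<and> w \<notin> set p"
  obtains x p y x' p' y' where "x \<in> A" "x' \<in> A" "y \<in> B" "y' \<in> B"
    "is_path E x p y" "is_path E x' p' y'" "set p \<inter> set p' = {}"
proof -
  define F where "F v \<longleftrightarrow> (\<exists>x\<in>A. \<exists>x'\<in>A. \<exists>y\<in>B. \<exists>L M.
      is_path E x L v \<and> is_path E x' M y \<and> set L \<inter> set M = {})" for v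
  have start: "F x" if "x \<in> A" for x
  proof -
    obtain x' y M where "x' \<in> A" "y \<in> B" "is_path E x' M y" "x \<notin> set M" using nosep by blast
    with that is_path_singleton[of E x] show ?thesis unfolding F_def
      by (metis disjoint_insert(1) empty_set inf_bot_right inf_commute list.simps(15))
  qed
  have step: "F v'" if Fv: "F v" and vv': "(v, v') \<in> E" for v v'
  proof -
    obtain x x' y L M where xA: "x \<in> A" "x' \<in> A" "y \<in> B"
      and L: "is_path E x L v" and M: "is_path E x' M y" and dj: "set L \<inter> set M = {}"
      using Fv unfolding F_def by blast
    show ?thesis
    proof (cases "v' \<in> set L")
      case True
      then obtain L1 L2 where "L = L1 @ v' # L2" by (meson split_list)
      then show ?thesis unfolding F_def
        using is_path_split(1)[of E x L1 v' L2 v] L M dj xA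
        by (intro bexI[of _ x] bexI[of _ x'] bexI[of _ y] exI[of _ "L1 @ [v']"] exI[of _ M]) auto
    next
      case vL: False
      show ?thesis
      proof (cases "v' \<in> set M")
        case False
        then show ?thesis unfolding F_def
          using is_path_snoc[OF L vv' vL] M dj xA
          by (intro bexI[of _ x] bexI[of _ x'] bexI[of _ y] exI[of _ "L @ [v']"] exI[of _ M]) auto
      next
        case True
        then obtain M1 M2 where MM: "M = M1 @ v' # M2" by (meson split_list)
        have M1: "is_path E x' (M1 @ [v']) v'" and M2: "is_path E v' (v' # M2) y"
          using is_path_split M MM by metis+
        \<comment> \<open>\<open>N\<close> avoids \<open>v'\<close> and decides the rerouting.
          Whichever of \<open>L\<close> and \<open>M1\<close> it leaves last is continued along
          \<open>N\<close>, or along \<open>M2\<close> once that is met, into \<open>B\<close>; the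
          other one is extended to \<open>v'\<close>. If it meets neither, the path into
          \<open>B\<close> starts at \<open>n\<close>, and \<open>M1\<close> is extended.\<close>
        obtain n n' N where n: "n \<in> A" "n' \<in> B" and N: "is_path E n N n'" "v' \<notin> set N"
          using nosep by blast
        let ?X = "set L \<union> set M1"
        \<comment> \<open>A path from the last vertex on \<open>?X\<close> into \<open>B\<close>, switching to \<open>M2\<close> as soon as it is met.\<close>
        have tail: "\<exists>S y'. y' \<in> B \<and> is_path E z (z # S) y' \<and> set S \<inter> (?X \<union> {v'}) = {}"
          if zN: "is_path E z (z # N2) n'" and N2: "set N2 \<inter> ?X = {}" "v' \<notin> set (z # N2)"
            and z: "z \<notin> set M2" for z N2
        proof (cases "set N2 \<inter> set M2 = {}")
          case True
          with zN N2 n show ?thesis by auto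
        next
          case False
          then obtain N3 u N4 where N3: "N2 = N3 @ u # N4" "u \<in> set M2" "set N3 \<inter> set M2 = {}"
            by (rule split_list_first_in)
          then obtain M3 M4 where M3: "M2 = M3 @ u # M4" by (meson split_list)
          have "is_path E z (z # N3 @ [u]) u"
            using is_path_split(1)[of E z "z # N3" u N4] zN N3 by auto
          moreover have "is_path E u (u # M4) y"
            using is_path_split(2)[of E v' "v' # M3" u M4] M2 M3 by auto
          ultimately have "is_path E z (z # N3 @ u # M4) y"
            using is_path_join[of E z "z # N3" u M4 y] N3 M3 z by auto
          moreover have "set M4 \<inter> (?X \<union> {v'}) = {}"
            using dj M MM M3 by (auto simp: is_path_def)
          ultimately show ?thesis using N3 N2 xA by (intro exI[of _ "N3 @ u # M4"] exI[of _ y]) auto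
        qed
        show ?thesis
        proof (cases "set N \<inter> ?X = {}")
          case True
          obtain N2 where N2: "N = n # N2" using N by (cases N) (auto simp: is_path_def)
          show ?thesis
          proof (cases "n \<in> set M2")
            case False
            with tail[of n N2] N N2 True obtain S y' where S: "y' \<in> B" "is_path E n (n # S) y'"
              "set S \<inter> (?X \<union> {v'}) = {}" by auto
            then show ?thesis unfolding F_def using M1 n xA N N2 True
              by (intro bexI[of _ x'] bexI[of _ n] bexI[of _ y'] exI[of _ "M1 @ [v']"]
                  exI[of _ "n # S"]) auto
          next
            case nM: True
            then obtain M3 M4 where M3: "M2 = M3 @ n # M4" by (meson split_list)
            have "is_path E n (n # M4) y"
              using is_path_split(2)[of E v' "v' # M3" n M4] M2 M3 by auto
            then show ?thesis unfolding F_def using M1 n xA M MM M3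
              by (intro bexI[of _ x'] bexI[of _ n] bexI[of _ y] exI[of _ "M1 @ [v']"]
                  exI[of _ "n # M4"]) (auto simp: is_path_def)
          qed
        next
          case False
          then obtain N1 z N2 where N2: "N = N1 @ z # N2" "z \<in> ?X" "set N2 \<inter> ?X = {}"
            by (rule split_list_last_in)
          have "is_path E z (z # N2) n'" using N N2 is_path_split(2) by metis
          moreover have "z \<notin> set M2" using N2 dj M MM by (auto simp: is_path_def)
          ultimately obtain S y' where S: "y' \<in> B" "is_path E z (z # S) y'"
              "set S \<inter> (?X \<union> {v'}) = {}" using tail[of z N2] N N2 by auto
          show ?thesis
          proof (cases "z \<in> set L")
            case True
            then obtain L1 L2 where L1: "L = L1 @ z # L2" by (meson split_list)
            have "is_path E x (L1 @ z # S) y'"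
              using is_path_join[OF is_path_split(1)[of E x L1 z L2 v] S(2)] L L1 S by auto
            moreover have "set (M1 @ [v']) \<inter> set (L1 @ z # S) = {}"
              using dj S(3) vL unfolding MM L1 by auto
            ultimately show ?thesis unfolding F_def using M1 S(1) xA by blast
          next
            case False
            then obtain K1 K2 where K1: "M1 = K1 @ z # K2" using N2 by (meson UnE split_list)
            have "is_path E x' (K1 @ z # S) y'"
              using is_path_join[OF is_path_split(1)[of E x' K1 z "K2 @ v' # M2" y] S(2)] M MM K1 S
              by auto
            moreover have "set (L @ [v']) \<inter> set (K1 @ z # S) = {}"
            proof -
              have "v' \<notin> set (K1 @ [z])" using M unfolding MM K1 is_path_def by auto
              then show ?thesis using dj S(3) unfolding MM K1 by auto
            qed
            ultimately show ?thesis unfolding F_def using is_path_snoc[OF L vv' vL] S(1) xA by blast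
          qed
        qed
      qed
    qed
  qed
  have path_F: "F y" if "is_path E x p y" "F x" for x p y
    using that
  proof (induction p arbitrary: x rule: vwalk_arcs.induct)
    case (3 a b xs)
    have "F b" using 3 step by (auto simp: is_path_def)
    with 3 show ?case by (auto simp: is_path_def)
  qed (auto simp: is_path_def)
  obtain x0 y0 p0 where "x0 \<in> A" "y0 \<in> B" "is_path E x0 p0 y0" using nosep by blast
  then have "F y0" using start path_F by blast
  then show ?thesis using that \<open>y0 \<in> B\<close> unfolding F_def by blast
qed

lemma is_path_first_hit:
  assumes "is_path E x p y" "y \<in> B"
  obtains p' y' where "is_path E x p' y'" "y' \<in> B" "set p' \<subseteq> set p" "set p' \<inter> B = {y'}"
proof -
  have "last p \<in> set p" using assms last_in_set by (auto simp: is_path_def simp del: last_in_set)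
  then have "y \<in> set p" using assms by (simp add: is_path_def)
  then have "set p \<inter> B \<noteq> {}" using assms by blast
  then obtain p1 z p2 where "p = p1 @ z # p2" "z \<in> B" "set p1 \<inter> B = {}"
    by (rule split_list_first_in)
  with that[of "p1 @ [z]" z] is_path_split(1)[of E x p1 z p2 y] assms show ?thesis by auto
qed


section \<open>Rooted trees\<close>

locale rtree =
  fixes V :: "'a set" and C :: "('a \<times> 'a) set" and rt :: 'a
  assumes fin_V: "finite V"
    and C_sub: "C \<subseteq> V \<times> V"
    and rt_in: "rt \<in> V"
    and reach: "v \<in> V \<Longrightarrow> (rt, v) \<in> C\<^sup>*"
    and parent_unique: "(u, v) \<in> C \<Longrightarrow> (u', v) \<in> C \<Longrightarrow> u = u'"
    and no_parent_rt: "(u, rt) \<notin> C"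
begin

abbreviation sub :: "'a \<Rightarrow> 'a set" where
  "sub v \<equiv> C\<^sup>* `` {v}"

text \<open>The parent is unique, so a cycle through a vertex also passes through its parent, and by
  induction through \<open>rt\<close>, which has no parent.\<close>

lemma acyclic: "(v, v) \<notin> C\<^sup>+"
proof
  assume cyc: "(v, v) \<in> C\<^sup>+"
  then have "v \<in> V" using C_sub trancl_subset_Sigma by blast
  then have "(rt, v) \<in> C\<^sup>*" by (rule reach)
  then have "(v, v) \<notin> C\<^sup>+"
  proof (induction rule: rtrancl_induct)
    case base
    show ?case using no_parent_rt tranclD2 by fast
  next
    case (step y z)
    show ?case
    proof
      assume "(z, z) \<in> C\<^sup>+"
      then obtain u where "(z, u) \<in> C\<^sup>*" "(u, z) \<in> C" using tranclD2 by metis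
      then have "(y, y) \<in> C\<^sup>+" using parent_unique step(2)
        by (metis rtrancl_into_trancl2)
      with step show False by blast
    qed
  qed
  with cyc show False by blast
qed

text \<open>Serves to pick a lowest member of a set, one whose children all lie outside the
  set.\<close>

lemma wf_converse: "wf (C\<inverse>)"
proof (rule finite_acyclic_wf_converse)
  show "finite C" using finite_subset[OF C_sub] fin_V by blast
  show "acyclic C" unfolding acyclic_def using acyclic by blast
qed

lemma antisym_desc: "(u, v) \<in> C\<^sup>* \<Longrightarrow> (v, u) \<in> C\<^sup>* \<Longrightarrow> u = v"
  using acyclic by (metis rtrancl_eq_or_trancl trancl_trans)

lemma child_not_above: "(u, v) \<in> C \<Longrightarrow> (v, u) \<notin> C\<^sup>*"
  using acyclic by (meson rtrancl_into_trancl2)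

lemma child_neq: "(u, v) \<in> C \<Longrightarrow> u \<noteq> v"
  using child_not_above by blast

lemma desc_in_V: "v \<in> V \<Longrightarrow> (v, u) \<in> C\<^sup>* \<Longrightarrow> u \<in> V"
  using C_sub by (metis SigmaD2 rtranclE subsetD)

lemma sub_subset_V: "v \<in> V \<Longrightarrow> sub v \<subseteq> V"
  using desc_in_V by blast

lemma above_parent: "(z, a) \<in> C\<^sup>* \<Longrightarrow> z \<noteq> a \<Longrightarrow> (p, a) \<in> C \<Longrightarrow> (z, p) \<in> C\<^sup>*"
  using parent_unique by (metis rtranclE)

lemma ancestors_linear:
  assumes "(u, v) \<in> C\<^sup>*" "(u', v) \<in> C\<^sup>*"
  shows "(u, u') \<in> C\<^sup>* \<or> (u', u) \<in> C\<^sup>*"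
  using assms
proof (induction arbitrary: u' rule: rtrancl_induct)
  case (step y z)
  then show ?case using above_parent by (metis rtrancl.rtrancl_into_rtrancl)
qed auto

lemma siblings_disjoint:
  assumes "(f, b) \<in> C" "(f, c) \<in> C" "b \<noteq> c"
  shows "sub b \<inter> sub c = {}"
proof -
  have False if "(b, z) \<in> C\<^sup>*" "(c, z) \<in> C\<^sup>*" for z
    using ancestors_linear[OF that] assms above_parent child_not_above by metis
  then show ?thesis by blast
qed

lemma obtain_child:
  assumes "(u, v) \<in> C\<^sup>*" "u \<noteq> v"
  obtains c where "(u, c) \<in> C" "(c, v) \<in> C\<^sup>*"
  using assms by (metis converse_rtranclE)

lemma tree_path:
  assumes "(u, v) \<in> C\<^sup>*"
  obtains p where "is_path C u p v" "set p = {z. (u, z) \<in> C\<^sup>* \<and> (z, v) \<in> C\<^sup>*}"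
proof -
  from assms have "\<exists>p. is_path C u p v \<and> set p = {z. (u, z) \<in> C\<^sup>* \<and> (z, v) \<in> C\<^sup>*}"
  proof (induction rule: rtrancl_induct)
    case base
    have "{z. (u, z) \<in> C\<^sup>* \<and> (z, u) \<in> C\<^sup>*} = {u}" using antisym_desc by auto
    then show ?case using is_path_singleton[of C u] by (intro exI[of _ "[u]"]) auto
  next
    case (step y z)
    then obtain p where p: "is_path C u p y" "set p = {z. (u, z) \<in> C\<^sup>* \<and> (z, y) \<in> C\<^sup>*}" by blast
    have "z \<notin> set p" using p step child_not_above by blast
    then have "is_path C u (p @ [z]) z" using p step is_path_snoc by metis
    moreover have "set (p @ [z]) = {x. (u, x) \<in> C\<^sup>* \<and> (x, z) \<in> C\<^sup>*}"
    proof -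
      have "(x, z) \<in> C\<^sup>* \<longleftrightarrow> x = z \<or> (x, y) \<in> C\<^sup>*" for x
        using above_parent step(2) by (meson r_into_rtrancl rtrancl.rtrancl_refl rtrancl_trans)
      moreover have "(u, z) \<in> C\<^sup>*" using step by simp
      ultimately show ?thesis using p(2) by auto
    qed
    ultimately show ?case by blast
  qed
  then show ?thesis using that by blast
qed

end


section \<open>Connectivity\<close>

definition conn :: "('a \<times> 'a) set \<Rightarrow> 'a set \<Rightarrow> bool" where
  "conn E S \<longleftrightarrow> S \<noteq> {} \<and> (\<forall>x\<in>S. \<forall>y\<in>S. (x, y) \<in> (E \<inter> S \<times> S)\<^sup>*)"

text \<open>Connectivity enters most later arguments through cuts: this gives the edge crossing a
  cut, and the next lemma recovers connectivity when every cut is crossed.\<close>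

lemma conn_edge_out:
  assumes "conn E S" "y \<in> Y" "y \<in> S" "z \<in> S" "z \<notin> Y"
  obtains u v where "u \<in> Y" "u \<in> S" "v \<in> S" "v \<notin> Y" "(u, v) \<in> E"
proof -
  have "(y, z) \<in> (E \<inter> S \<times> S)\<^sup>*" using assms by (auto simp: conn_def)
  then have "z \<notin> Y \<longrightarrow> (\<exists>u v. u \<in> Y \<and> u \<in> S \<and> v \<in> S \<and> v \<notin> Y \<and> (u, v) \<in> E)"
    by (induction rule: rtrancl_induct) (use assms in auto)
  then show ?thesis using that assms by blast
qed

lemma conn_if_edges_out:
  assumes "S \<noteq> {}"
    and "\<And>Y. Y \<subseteq> S \<Longrightarrow> Y \<noteq> {} \<Longrightarrow> Y \<noteq> S \<Longrightarrow> \<exists>u\<in>Y. \<exists>v\<in>S - Y. (u, v) \<in> E"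
  shows "conn E S"
proof -
  have "(x, y) \<in> (E \<inter> S \<times> S)\<^sup>*" if "x \<in> S" "y \<in> S" for x y
  proof (rule ccontr)
    assume no: "(x, y) \<notin> (E \<inter> S \<times> S)\<^sup>*"
    let ?Y = "{z \<in> S. (x, z) \<in> (E \<inter> S \<times> S)\<^sup>*}"
    have "\<exists>u\<in>?Y. \<exists>v\<in>S - ?Y. (u, v) \<in> E" by (rule assms(2)) (use that no in auto)
    then show False using rtrancl.rtrancl_into_rtrancl[of x _ "E \<inter> S \<times> S"] by blast
  qed
  with assms show ?thesis by (auto simp: conn_def)
qed

lemma conn_if_hub:
  assumes "h \<in> S" "sym E" "\<And>x. x \<in> S \<Longrightarrow> (h, x) \<in> (E \<inter> S \<times> S)\<^sup>*"
  shows "conn E S"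
proof -
  have s: "sym ((E \<inter> S \<times> S)\<^sup>*)" using assms(2) by (intro sym_rtrancl) (auto simp: sym_def)
  have "(x, y) \<in> (E \<inter> S \<times> S)\<^sup>*" if "x \<in> S" "y \<in> S" for x y
    using s assms(3)[OF that(1)] assms(3)[OF that(2)] by (metis rtrancl_trans symD)
  with assms show ?thesis by (auto simp: conn_def)
qed

lemma rtrancl_on_restrict_iff:
  assumes "x \<in> S"
  shows "(x, y) \<in> rtrancl_on S (E \<inter> S \<times> S) \<longleftrightarrow> (x, y) \<in> (E \<inter> S \<times> S)\<^sup>*"
proof
  assume "(x, y) \<in> rtrancl_on S (E \<inter> S \<times> S)"
  then show "(x, y) \<in> (E \<inter> S \<times> S)\<^sup>*" by (rule rtrancl_on_rtranclI)
next
  assume "(x, y) \<in> (E \<inter> S \<times> S)\<^sup>*"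
  then show "(x, y) \<in> rtrancl_on S (E \<inter> S \<times> S)"
    by (induction rule: rtrancl_induct) (use assms in \<open>auto intro: rtrancl_on_into_rtrancl_on\<close>)
qed

text \<open>\<open>connected\<close> refers to the symmetric closure, which adds nothing because the
  arcs of a \<open>pair_graph\<close> are already symmetric.\<close>

lemma connected_induce_iff_conn:
  assumes "pair_graph G"
  shows "connected (with_proj G \<restriction> S) \<longleftrightarrow> conn (parcs G) S"
proof -
  interpret pair_graph G by fact
  have "sym (parcs G)" using pair_sym_arcs by (simp add: symmetric_def)
  then have "parcs (mk_symmetric (with_proj G \<restriction> S)) = parcs G \<inter> S \<times> S"
    "pverts (mk_symmetric (with_proj G \<restriction> S)) = S"
    by (auto simp: mk_symmetric_def arcs_ends_conv sym_def)
  then show ?thesis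
    unfolding connected_def strongly_connected_def reachable_def conn_def
    by (simp add: rtrancl_on_restrict_iff arcs_ends_conv cong: ball_cong)
qed

lemma connected_iff_conn:
  assumes "pair_graph G"
  shows "connected (with_proj G) \<longleftrightarrow> conn (parcs G) (pverts G)"
proof -
  interpret pair_graph G by fact
  have "with_proj G \<restriction> pverts G = with_proj G"
    by (auto simp: induce_subgraph_def with_proj_def dest: in_arcsD1 in_arcsD2)
  then show ?thesis using connected_induce_iff_conn[OF assms, of "pverts G"] by simp
qed

lemma two_connected_iff:
  "two_connected G \<longleftrightarrow> pair_graph G \<and> 3 \<le> card (pverts G) \<and> conn (parcs G) (pverts G) \<and>
     (\<forall>v \<in> pverts G. conn (parcs G) (pverts G - {v}))"
  unfolding two_connected_def by (auto simp: connected_iff_conn connected_induce_iff_conn)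


section \<open>Subdivided binary trees\<close>

text \<open>
  A subdivided complete binary tree, oriented away from its root; \<open>ht v\<close> is the number of
  branching levels below \<open>v\<close>, so it stays constant along a subdivided edge.
\<close>

locale sdtree = rtree V C rt for V :: "'a set" and C rt +
  fixes ht :: "'a \<Rightarrow> nat"
  assumes ht_cases: "v \<in> V \<Longrightarrow> (C `` {v} = {} \<and> ht v = 0) \<or> (\<exists>c. C `` {v} = {c} \<and> ht c = ht v) \<or>
     (\<exists>b c. b \<noteq> c \<and> C `` {v} = {b, c} \<and> ht v = Suc (ht b) \<and> ht c = ht b)"

lemma (in sdtree) ht_casesE:
  assumes "v \<in> V"
  obtains (leaf) "C `` {v} = {}" "ht v = 0" | (chain) c where "C `` {v} = {c}" "ht c = ht v"
    | (branch) b c where "b \<noteq> c" "C `` {v} = {b, c}" "ht v = Suc (ht b)" "ht c = ht b"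
proof -
  from ht_cases[OF assms] show ?thesis
  proof (elim disjE exE conjE)
  qed (rule that; assumption)+
qed

text \<open>Moves the tree of bit strings onto the branch vertices in \<open>G\<close>; heights are
  read off through the inverse of \<open>f\<close>.\<close>

lemma sdtree_image:
  assumes "sdtree V C rt ht" and inj: "inj_on f V"
  shows "sdtree (f ` V) (map_prod f f ` C) (f rt) (ht \<circ> the_inv_into V f)"
proof -
  interpret sdtree V C rt ht by fact
  have inv: "the_inv_into V f (f x) = x" if "x \<in> V" for x
    using inj that by (rule the_inv_into_f_f)
  have CV: "x \<in> V" "y \<in> V" if "(x, y) \<in> C" for x y using that C_sub by auto
  have step: "(f x, f y) \<in> (map_prod f f ` C)\<^sup>*" if "(x, y) \<in> C\<^sup>*" for x y
    using that
    by (induction rule: rtrancl_induct) (auto intro: rtrancl.rtrancl_into_rtrancl)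
  have img: "(map_prod f f ` C) `` {f v} = f ` (C `` {v})" if "v \<in> V" for v
  proof
    show "f ` (C `` {v}) \<subseteq> (map_prod f f ` C) `` {f v}" by force
    show "(map_prod f f ` C) `` {f v} \<subseteq> f ` (C `` {v})"
    proof
      fix y assume "y \<in> (map_prod f f ` C) `` {f v}"
      then obtain a b where ab: "(a, b) \<in> C" "f a = f v" "y = f b" by auto
      then have "a = v" using inj_onD[OF inj] CV that by metis
      with ab show "y \<in> f ` (C `` {v})" by blast
    qed
  qed
  show ?thesis
  proof
    show "finite (f ` V)" using fin_V by simp
    show "map_prod f f ` C \<subseteq> f ` V \<times> f ` V" using C_sub by auto
    show "f rt \<in> f ` V" using rt_in by simp
    show "(f rt, v) \<in> (map_prod f f ` C)\<^sup>*" if "v \<in> f ` V" for v using that reach step by blast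
    show "u = u'" if uv: "(u, v) \<in> map_prod f f ` C" "(u', v) \<in> map_prod f f ` C" for u u' v
    proof -
      obtain x y where xy: "(x, y) \<in> C" "u = f x" "v = f y" using uv(1) by auto
      obtain x' y' where xy': "(x', y') \<in> C" "u' = f x'" "v = f y'" using uv(2) by auto
      have "y = y'" using xy xy' inj_onD[OF inj] CV by metis
      then show ?thesis using xy xy' parent_unique by blast
    qed
    show "(u, f rt) \<notin> map_prod f f ` C" for u
    proof
      assume "(u, f rt) \<in> map_prod f f ` C"
      then obtain x y where "(x, y) \<in> C" "f y = f rt" by auto
      then show False using inj_onD[OF inj] CV rt_in no_parent_rt by metis
    qed
  next
    fix v assume "v \<in> f ` V"
    then obtain x where x: "x \<in> V" "v = f x" by blast
    have CVx: "y \<in> V" if "y \<in> C `` {x}" for y using that CV by blast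
    from x(1) show "((map_prod f f ` C) `` {v} = {} \<and> (ht \<circ> the_inv_into V f) v = 0) \<or>
       (\<exists>c. (map_prod f f ` C) `` {v} = {c} \<and> (ht \<circ> the_inv_into V f) c = (ht \<circ> the_inv_into V f) v) \<or>
       (\<exists>b c. b \<noteq> c \<and> (map_prod f f ` C) `` {v} = {b, c} \<and>
          (ht \<circ> the_inv_into V f) v = Suc ((ht \<circ> the_inv_into V f) b) \<and>
          (ht \<circ> the_inv_into V f) c = (ht \<circ> the_inv_into V f) b)"
    proof (cases rule: ht_casesE)
      case leaf
      then show ?thesis using x img inv by simp
    next
      case (chain c)
      then have "c \<in> V" using CVx by blast
      with chain have "(map_prod f f ` C) `` {v} = {f c}"
          "(ht \<circ> the_inv_into V f) (f c) = (ht \<circ> the_inv_into V f) v"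
        using x img inv by simp_all
      then show ?thesis by blast
    next
      case (branch b c)
      then have bc: "b \<in> V" "c \<in> V" using CVx by blast+
      then have "f b \<noteq> f c" using branch inj_onD[OF inj] by blast
      moreover have "(map_prod f f ` C) `` {v} = {f b, f c}"
          "(ht \<circ> the_inv_into V f) v = Suc ((ht \<circ> the_inv_into V f) (f b))"
          "(ht \<circ> the_inv_into V f) (f c) = (ht \<circ> the_inv_into V f) (f b)"
        using branch x img inv bc by simp_all
      ultimately show ?thesis by blast
    qed
  qed
qed

lemma sdtree_Gamma:
  "sdtree {w. length w \<le> k} {(w, b # w) | w b. length w < k} [] (\<lambda>w :: bool list. k - length w)"
proof
  show "finite {w :: bool list. length w \<le> k}"
    using finite_lists_length_le[of "UNIV :: bool set" k] by simp
  show "([], v) \<in> {(w, b # w) |w b. length w < k}\<^sup>*" if "v \<in> {w. length w \<le> k}" for v :: "bool list"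
    using that
  proof (induction v)
    case (Cons b v)
    then have "(v, b # v) \<in> {(w, b # w) |w b. length w < k}" by auto
    with Cons show ?case by (auto intro: rtrancl.rtrancl_into_rtrancl)
  qed simp
  fix v :: "bool list" assume "v \<in> {w. length w \<le> k}"
  then show "({(w, b # w) |w b. length w < k} `` {v} = {} \<and> k - length v = 0) \<or>
    (\<exists>c. {(w, b # w) |w b. length w < k} `` {v} = {c} \<and> k - length c = k - length v) \<or>
    (\<exists>b c. b \<noteq> c \<and> {(w, b # w) |w b. length w < k} `` {v} = {b, c} \<and>
       k - length v = Suc (k - length b) \<and> k - length c = k - length b)"
  proof (cases "length v < k")
    case True
    then have "{(w, b # w) |w b. length w < k} `` {v} = {True # v, False # v}" by auto
    moreover have "k - length v = Suc (k - length (True # v))" using True by auto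
    ultimately show ?thesis by (metis length_Cons list.inject)
  qed auto
qed auto

text \<open>The new vertex takes the height of the lower end \<open>v\<close>. It thus becomes a
  chain vertex, and since it replaces \<open>v\<close> below \<open>u\<close> with the same height,
  \<open>u\<close> stays a chain or branching vertex.\<close>

lemma sdtree_subdivide:
  assumes "sdtree V C rt ht" and w: "w \<notin> V" and uv: "(u, v) \<in> C"
  shows "sdtree (insert w V) (C - {(u, v)} \<union> {(u, w), (w, v)}) rt (ht(w := ht v))"
proof -
  interpret sdtree V C rt ht by fact
  let ?C = "C - {(u, v)} \<union> {(u, w), (w, v)}"
  have CV: "x \<in> V" "y \<in> V" if "(x, y) \<in> C" for x y using that C_sub by auto
  have uvV: "u \<in> V" "v \<in> V" "u \<noteq> v" "w \<noteq> u" "w \<noteq> v" using CV uv child_neq w by blast+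
  have one: "(x, y) \<in> ?C\<^sup>*" if "(x, y) \<in> C" for x y
  proof (cases "(x, y) = (u, v)")
    case True
    have "(u, w) \<in> ?C" "(w, v) \<in> ?C" by auto
    then have "(u, v) \<in> ?C\<^sup>*" by (rule rtrancl_trans[OF r_into_rtrancl r_into_rtrancl])
    with True show ?thesis by simp
  qed (use that in auto)
  have step: "(x, y) \<in> ?C\<^sup>*" if "(x, y) \<in> C\<^sup>*" for x y
    using that by (induction rule: rtrancl_induct) (blast intro: rtrancl_trans one)+
  show ?thesis
  proof
    show "finite (insert w V)" using fin_V by simp
    show "?C \<subseteq> insert w V \<times> insert w V" using C_sub uvV by auto
    show "rt \<in> insert w V" using rt_in by simp
    show "(rt, z) \<in> ?C\<^sup>*" if z: "z \<in> insert w V" for z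
    proof (cases "z = w")
      case True
      have "(rt, u) \<in> ?C\<^sup>*" using reach uvV step by blast
      then show ?thesis using True by (auto intro: rtrancl.rtrancl_into_rtrancl)
    qed (use z reach step in blast)
    show "x = x'" if "(x, y) \<in> ?C" "(x', y) \<in> ?C" for x x' y
      using that parent_unique uv CV w by blast
    show "(x, rt) \<notin> ?C" for x using no_parent_rt uv rt_in w by auto
  next
    fix z assume "z \<in> insert w V"
    then consider "z = w" | "z = u" | "z \<in> V" "z \<noteq> u" "z \<noteq> w" using w uvV by blast
    then show "(?C `` {z} = {} \<and> (ht(w := ht v)) z = 0) \<or>
       (\<exists>c. ?C `` {z} = {c} \<and> (ht(w := ht v)) c = (ht(w := ht v)) z) \<or>
       (\<exists>b c. b \<noteq> c \<and> ?C `` {z} = {b, c} \<and> (ht(w := ht v)) z = Suc ((ht(w := ht v)) b) \<and>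
          (ht(w := ht v)) c = (ht(w := ht v)) b)"
    proof cases
      case 1
      have "?C `` {w} = {v}" using w CV uvV by auto
      with 1 uvV show ?thesis by auto
    next
      case 2
      have im: "?C `` {u} = insert w (C `` {u} - {v})" using uvV by auto
      have nw: "w \<notin> C `` {u}" using w CV by blast
      have "v \<in> C `` {u}" using uv by blast
      have two: ?thesis
        if "c \<noteq> v" "C `` {u} = {v, c}" "ht u = Suc (ht v)" "ht c = ht v" for c
      proof -
        have "?C `` {u} = {w, c}" "c \<noteq> w" using im nw that by auto
        then show ?thesis using that 2 uvV
          by (intro disjI2) (rule exI[of _ w], rule exI[of _ c], auto)
      qed
      from uvV(1) show ?thesis
      proof (cases rule: ht_casesE)
        case leaf
        then show ?thesis using \<open>v \<in> C `` {u}\<close> by (metis emptyE)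
      next
        case (chain c)
        then have "c = v" using \<open>v \<in> C `` {u}\<close> by (metis singletonD)
        with chain 2 im uvV show ?thesis by auto
      next
        case (branch b c)
        then consider "v = b" | "v = c" using \<open>v \<in> C `` {u}\<close> by (metis insertE singletonD)
        then show ?thesis
        proof cases
          case 1
          show ?thesis by (rule two[of c]) (use 1 branch in simp_all)
        next
          case 2
          show ?thesis by (rule two[of b]) (use 2 branch in \<open>simp_all add: insert_commute\<close>)
        qed
      qed
    next
      case 3
      have im: "?C `` {z} = C `` {z}" using 3 by auto
      have nw: "w \<notin> C `` {z}" using w CV by blast
      from 3(1) show ?thesis
      proof (cases rule: ht_casesE)
        case leaf
        then show ?thesis using im 3 by simp
      next
        case (chain c)
        then have "c \<noteq> w" using nw by blast
        then show ?thesis using im chain 3 by auto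
      next
        case (branch b c)
        then have "c \<noteq> w" "b \<noteq> w" using nw by blast+
        then show ?thesis using im branch \<open>z \<noteq> w\<close>
          by (intro disjI2) (rule exI[of _ b], rule exI[of _ c], auto)
      qed
    qed
  qed
qed

text \<open>Orientation and heights are carried through each subdivision step. The last conclusion
  serves minimality: a minor that still has \<open>H\<close> as a subgraph also contains a
  subdivision of \<open>Gamma k\<close>.\<close>

lemma contains_subdivision_Gamma_imp_sdtree:
  fixes G :: "'a pair_pre_digraph"
  assumes "contains_subdivision G (Gamma k)"
  obtains H C rt ht where "sdtree (pverts H) C rt ht" "ht rt = k" "parcs H = C \<union> C\<inverse>"
    "subgraph (with_proj H) (with_proj G)"
    "\<And>G' :: 'a pair_pre_digraph. subgraph (with_proj H) (with_proj G') \<Longrightarrow> contains_subdivision G' (Gamma k)"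
proof -
  obtain K H where iso: "digraph_iso (with_proj (Gamma k)) (with_proj K)"
    and sd: "subdivision_pair K H" and sub: "subgraph (with_proj H) (with_proj G)"
    using assms unfolding contains_subdivision_def by blast
  obtain h where h: "pre_digraph.digraph_isomorphism (with_proj (Gamma k)) h"
    "with_proj K = app_iso h (with_proj (Gamma k))"
    using iso unfolding digraph_iso_def by blast
  let ?f = "iso_verts h" and ?V = "{w :: bool list. length w \<le> k}"
  let ?C = "{(w, b # w) | w b. length w < k} :: (bool list \<times> bool list) set"
  have inj: "inj_on ?f ?V"
    using h(1) by (simp add: pre_digraph.digraph_isomorphism_def Gamma_def)
  have tl: "iso_tail h = fst" using arg_cong[OF h(2), of tail] by simp
  have hd: "iso_head h = snd" using arg_cong[OF h(2), of head] by simp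
  have "iso_arcs h a = map_prod ?f ?f a" if "a \<in> parcs (Gamma k)" for a
    using h(1) tl hd that by (auto simp: pre_digraph.digraph_isomorphism_def prod_eq_iff)
  moreover have "parcs K = iso_arcs h ` parcs (Gamma k)"
    using arg_cong[OF h(2), of arcs] by simp
  ultimately have K: "parcs K = map_prod ?f ?f ` parcs (Gamma k)" by auto
  have "parcs (Gamma k) = ?C \<union> ?C\<inverse>" by (auto simp: Gamma_def)
  then have K: "parcs K = map_prod ?f ?f ` ?C \<union> (map_prod ?f ?f ` ?C)\<inverse>"
    unfolding K by (auto simp: image_Un image_iff)
  have KV: "pverts K = ?f ` ?V"
    using arg_cong[OF h(2), of verts] by (simp add: Gamma_def)
  let ?P = "\<lambda>H. \<exists>C rt ht. sdtree (pverts H) C rt ht \<and> ht rt = k \<and> parcs H = C \<union> C\<inverse>"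
  have "(k - length ([] :: bool list)) = k" by simp
  then have "((\<lambda>w. k - length w) \<circ> the_inv_into ?V ?f) (?f []) = k"
    using the_inv_into_f_f[OF inj, of "[]"] by simp
  with sdtree_image[OF sdtree_Gamma inj, folded KV] K have PK: "?P K" by (intro exI conjI)
  from sd have "?P H"
  proof (induction rule: subdivision_pair_induct)
    case base
    show ?case by (rule PK)
  next
    case (divide e w H)
    then obtain C rt ht where C: "sdtree (pverts H) C rt ht" "ht rt = k" "parcs H = C \<union> C\<inverse>"
      by blast
    interpret sdtree "pverts H" C rt ht by fact
    \<comment> \<open>The subdivided arc may be given in either direction; \<open>(u, v)\<close> is
      its orientation away from the root.\<close>
    obtain u v where uv: "(u, v) \<in> C" "e = (u, v) \<or> e = (v, u)" using divide(1) C(3) by (cases e) auto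
    have pv: "pverts (subdivide H e w) = insert w (pverts H)"
      using uv(2) by (auto simp: subdivide.simps)
    have "(v, u) \<notin> C" using child_not_above[OF uv(1)] r_into_rtrancl by metis
    then have "(C \<union> C\<inverse>) - {(u, v), (v, u)} = (C - {(u, v)}) \<union> (C - {(u, v)})\<inverse>" by auto
    moreover have "A \<union> A\<inverse> \<union> {(u, w), (w, u), (w, v), (v, w)} =
        (A \<union> {(u, w), (w, v)}) \<union> (A \<union> {(u, w), (w, v)})\<inverse>" for A by auto
    moreover have "parcs (subdivide H e w) =
        (parcs H - {(u, v), (v, u)}) \<union> {(u, w), (w, u), (w, v), (v, w)}"
      using uv(2) by (elim disjE) (auto simp: subdivide.simps)
    ultimately have "parcs (subdivide H e w) =
        (C - {(u, v)} \<union> {(u, w), (w, v)}) \<union> (C - {(u, v)} \<union> {(u, w), (w, v)})\<inverse>"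
      unfolding C(3) by metis
    moreover have "rt \<noteq> w" using rt_in divide(2) by blast
    then have "(ht(w := ht v)) rt = k" using C(2) by simp
    ultimately show ?case using sdtree_subdivide[OF C(1) divide(2) uv(1), folded pv] by blast
  qed
  moreover have "contains_subdivision G' (Gamma k)"
    if "subgraph (with_proj H) (with_proj G')" for G' :: "'a pair_pre_digraph"
    using that iso sd unfolding contains_subdivision_def by blast
  ultimately show ?thesis using that sub by blast
qed

text \<open>A lowest vertex of height \<open>Suc h\<close> below \<open>v\<close> must branch: it is
  no leaf since its height is positive, and the only child of a chain vertex would have the same
  height and lie lower.\<close>

lemma (in sdtree) branch_below:
  assumes "v \<in> V" "ht v = Suc h"
  obtains f b c where "(v, f) \<in> C\<^sup>*" "ht f = Suc h" "b \<noteq> c" "C `` {f} = {b, c}" "ht b = h" "ht c = h"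
proof -
  define M where "M = {z. (v, z) \<in> C\<^sup>* \<and> ht z = Suc h}"
  have MV: "M \<subseteq> V" using assms sub_subset_V by (auto simp: M_def)
  have "v \<in> M" using assms by (simp add: M_def)
  then obtain f where f: "f \<in> M" "\<And>y. (y, f) \<in> C\<inverse> \<Longrightarrow> y \<notin> M"
    using wfE_min[OF wf_converse] by metis
  have "f \<in> V" using f MV by blast
  then show ?thesis
  proof (cases rule: ht_casesE)
    case leaf
    then show ?thesis using f by (simp add: M_def)
  next
    case (chain c)
    then have "(f, c) \<in> C" by (metis Image_singleton_iff singletonI)
    moreover have "(v, c) \<in> C\<^sup>*" using f(1) calculation by (auto simp: M_def)
    ultimately have "c \<in> M" using chain f(1) by (simp add: M_def)
    then show ?thesis using f(2) \<open>(f, c) \<in> C\<close> by (metis converseI)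
  next
    case (branch b c)
    with f(1) show ?thesis by (intro that[of f b c]) (simp_all add: M_def)
  qed
qed


section \<open>The subdivision spans a minor-minimal graph\<close>

lemma conn_mono:
  assumes "conn E S" "E \<inter> S \<times> S \<subseteq> F"
  shows "conn F S"
  using assms rtrancl_mono[of "E \<inter> S \<times> S" "F \<inter> S \<times> S"] unfolding conn_def by blast

text \<open>A detour through \<open>K\<close> replaces the edge, since deleting either of
  \<open>u\<close> and \<open>v\<close> forces an edge from \<open>K\<close> to the other. The set
  \<open>W\<close> is separate from \<open>V\<close> because the lemma is applied to the whole
  vertex set and to the vertex set minus one vertex.\<close>

lemma conn_delete_edge:
  assumes "sym E" "conn E W" "conn E (V - {u})" "conn E (V - {v})"
    and K: "K \<noteq> {}" "K \<subseteq> W" "W \<subseteq> V" "\<And>x y. x \<in> K \<Longrightarrow> (x, y) \<in> E \<Longrightarrow> y \<in> K \<union> {u, v}"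
    and uv: "u \<in> W" "v \<in> W" "u \<notin> K" "v \<notin> K" "u \<noteq> v"
  shows "conn (E - {(u, v), (v, u)}) W"
proof (rule conn_if_edges_out)
  show "W \<noteq> {}" using uv by blast
  fix X assume X: "X \<subseteq> W" "X \<noteq> {}" "X \<noteq> W"
  let ?E = "E - {(u, v), (v, u)}"
  have aux: "\<exists>x\<in>X. \<exists>y\<in>W - X. (x, y) \<in> ?E"
    if conn: "conn E (V - {a})" "conn E (V - {b})" and ab: "{a, b} = {u, v}" "a \<in> X" "b \<notin> X" for a b
  \<comment> \<open>\<open>X\<close> separates \<open>a\<close> from \<open>b\<close>. If it meets
    \<open>K\<close>, an edge leaving \<open>K \<inter> X\<close> without \<open>a\<close> ends in
    \<open>K - X\<close> or at \<open>b\<close>; otherwise \<open>K\<close> lies outside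
    \<open>X\<close> and, without \<open>b\<close>, has an edge to \<open>a\<close>.\<close>
  proof (cases "K \<inter> X = {}")
    case False
    have ne: "a \<noteq> b" "a \<notin> K" "b \<notin> K" "b \<in> W" using ab uv by auto
    obtain x' where x': "x' \<in> K \<inter> X" using False by blast
    have "x' \<in> V - {a}" "b \<in> V - {a}" "b \<notin> K \<inter> X" using x' ne K by auto
    then obtain x y where "x \<in> K \<inter> X" "x \<in> V - {a}" "y \<in> V - {a}" "y \<notin> K \<inter> X" "(x, y) \<in> E"
      by (rule conn_edge_out[OF conn(1) x'])
    moreover then have "y \<in> K \<union> {b}" using K(4) ab by blast
    ultimately have "x \<in> X" "y \<in> W - X" "(x, y) \<in> ?E" using K ab ne uv by auto
    then show ?thesis by blast
  next
    case True
    have ne: "a \<noteq> b" "a \<notin> K" "b \<notin> K" "a \<in> W" using ab uv by auto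
    obtain x' where x': "x' \<in> K" using K by blast
    have "x' \<in> V - {b}" "a \<in> V - {b}" "a \<notin> K" using x' ne K by auto
    then obtain x y where "x \<in> K" "x \<in> V - {b}" "y \<in> V - {b}" "y \<notin> K" "(x, y) \<in> E"
      by (rule conn_edge_out[OF conn(2) x'])
    moreover then have "y = a" using K(4) ab by blast
    ultimately have "a \<in> X" "x \<in> W - X" "(a, x) \<in> ?E"
      using True K ab ne uv \<open>sym E\<close> by (auto simp: sym_def)
    then show ?thesis by blast
  qed
  obtain x' z where "x' \<in> X" "x' \<in> W" "z \<in> W" "z \<notin> X" using X by blast
  then obtain x y where xy: "x \<in> X" "x \<in> W" "y \<in> W" "y \<notin> X" "(x, y) \<in> E"
    by (rule conn_edge_out[OF assms(2)])
  show "\<exists>x\<in>X. \<exists>y\<in>W - X. (x, y) \<in> ?E"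
  proof (cases "(x, y) \<in> ?E")
    case False
    then have "x = u \<and> y = v \<or> x = v \<and> y = u" using xy by blast
    then show ?thesis using aux[of u v] aux[of v u] assms(3,4) xy by auto
  qed (use xy in blast)
qed

lemma digraph_iso_card:
  assumes "digraph_iso (with_proj H) (with_proj G)"
  shows "card (pverts G) = card (pverts H)" "card (parcs G) = card (parcs H)"
proof -
  obtain h where h: "pre_digraph.digraph_isomorphism (with_proj H) h" "with_proj G = app_iso h (with_proj H)"
    using assms unfolding digraph_iso_def by blast
  have "pverts G = iso_verts h ` pverts H" "parcs G = iso_arcs h ` parcs H"
    using arg_cong[OF h(2), of verts] arg_cong[OF h(2), of arcs] by simp_all
  moreover have "inj_on (iso_verts h) (pverts H)" "inj_on (iso_arcs h) (parcs H)"
    using h(1) by (simp_all add: pre_digraph.digraph_isomorphism_def)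
  ultimately show "card (pverts G) = card (pverts H)" "card (parcs G) = card (parcs H)"
    by (simp_all add: card_image)
qed

lemma subgraph_pairI:
  assumes "pair_wf_digraph G" "pair_wf_digraph H" "pverts H \<subseteq> pverts G" "parcs H \<subseteq> parcs G"
  shows "subgraph (with_proj H) (with_proj G)"
  using assms
  by (auto simp: subgraph_def compatible_def wf_digraph_wp_iff)

section \<open>Deletion and contraction of an edge\<close>

definition delete_edge :: "'a pair_pre_digraph \<Rightarrow> 'a \<Rightarrow> 'a \<Rightarrow> 'a pair_pre_digraph" where
  "delete_edge G u v = \<lparr> pverts = pverts G, parcs = parcs G - {(u, v), (v, u)} \<rparr>"

text \<open>The merged vertex keeps the name \<open>u\<close>, so a subgraph that avoids
  \<open>v\<close> remains a subgraph without renaming; \<open>x \<noteq> u\<close> prevents a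
  loop.\<close>

definition contract_edge :: "'a pair_pre_digraph \<Rightarrow> 'a \<Rightarrow> 'a \<Rightarrow> 'a pair_pre_digraph" where
  "contract_edge G u v = \<lparr> pverts = pverts G - {v},
     parcs = (parcs G \<inter> (pverts G - {v}) \<times> (pverts G - {v})) \<union>
       {(u, x) | x. (v, x) \<in> parcs G \<and> x \<noteq> u} \<union> {(x, u) | x. (x, v) \<in> parcs G \<and> x \<noteq> u} \<rparr>"

context
  fixes G :: "'a pair_pre_digraph" and u v :: 'a
  assumes G: "pair_graph G" and uv: "(u, v) \<in> parcs G"
begin

interpretation pair_graph G by (rule G)

lemma sym_parcs: "sym (parcs G)"
  using pair_sym_arcs by (simp add: symmetric_def)

lemma edge_facts: "u \<in> pverts G" "v \<in> pverts G" "u \<noteq> v" "(v, u) \<in> parcs G"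
  using uv sym_parcs by (auto dest: in_arcsD1 in_arcsD2 no_loops' symD)

lemma pair_graph_delete_edge: "pair_graph (delete_edge G u v)"
proof
  show "symmetric (with_proj (delete_edge G u v))"
    using sym_parcs by (auto simp: delete_edge_def symmetric_def sym_def)
  show "finite (parcs (delete_edge G u v))" "finite (pverts (delete_edge G u v))"
    by (auto simp: delete_edge_def)
qed (auto simp: delete_edge_def dest: in_arcsD1 in_arcsD2 no_loops')

lemma pair_graph_contract_edge: "pair_graph (contract_edge G u v)"
proof
  have "parcs (contract_edge G u v) \<subseteq> pverts G \<times> pverts G"
    using edge_facts by (auto simp: contract_edge_def dest: in_arcsD1 in_arcsD2)
  then show "finite (parcs (contract_edge G u v))" by (rule finite_subset) auto
  show "symmetric (with_proj (contract_edge G u v))"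
    using sym_parcs by (auto simp: contract_edge_def symmetric_def sym_def)
  show "finite (pverts (contract_edge G u v))" by (auto simp: contract_edge_def)
qed (use edge_facts in \<open>auto simp: contract_edge_def dest: in_arcsD1 in_arcsD2 no_loops'\<close>)

lemma delete_edge_proper_minor: "proper_minor_of (delete_edge G u v) G"
  unfolding proper_minor_of_def
proof
  show "minor_of (delete_edge G u v) G"
    unfolding minor_of_def
  proof (intro conjI exI[of _ "\<lambda>x. {x}"])
    show "pair_graph (delete_edge G u v)" by (rule pair_graph_delete_edge)
    show "pair_graph G" by (rule G)
    show "\<forall>x\<in>pverts (delete_edge G u v). {x} \<subseteq> pverts G \<and> connected (with_proj G \<restriction> {x})"
      by (auto simp: delete_edge_def connected_induce_iff_conn[OF G] conn_def)
  qed (auto simp: delete_edge_def)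
  show "\<not> digraph_iso (with_proj (delete_edge G u v)) (with_proj G)"
  proof
    assume "digraph_iso (with_proj (delete_edge G u v)) (with_proj G)"
    then have "card (parcs G) = card (parcs G - {(u, v), (v, u)})"
      using digraph_iso_card(2) by (fastforce simp: delete_edge_def)
    moreover have "parcs G - {(u, v), (v, u)} \<subset> parcs G" using uv by blast
    ultimately show False using psubset_card_mono[OF pair_finite_arcs] by (metis less_irrefl)
  qed
qed

lemma contract_edge_proper_minor: "proper_minor_of (contract_edge G u v) G"
  unfolding proper_minor_of_def
proof
  let ?m = "\<lambda>x. if x = u then {u, v} else {x}"
  show "minor_of (contract_edge G u v) G"
    unfolding minor_of_def
  proof (intro conjI exI[of _ ?m])
    show "pair_graph (contract_edge G u v)" by (rule pair_graph_contract_edge)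
    show "pair_graph G" by (rule G)
    have "conn (parcs G) {u, v}"
      using edge_facts uv by (auto simp: conn_def intro!: r_into_rtrancl)
    then show "\<forall>x\<in>pverts (contract_edge G u v). ?m x \<subseteq> pverts G \<and> connected (with_proj G \<restriction> ?m x)"
      using edge_facts by (auto simp: contract_edge_def connected_induce_iff_conn[OF G] conn_def)
  qed (use edge_facts sym_parcs in \<open>auto simp: contract_edge_def sym_def\<close>)
  show "\<not> digraph_iso (with_proj (contract_edge G u v)) (with_proj G)"
  proof
    assume "digraph_iso (with_proj (contract_edge G u v)) (with_proj G)"
    then have "card (pverts G) = card (pverts G - {v})"
      using digraph_iso_card(1) by (fastforce simp: contract_edge_def)
    moreover have "pverts G - {v} \<subset> pverts G" using edge_facts by blast
    ultimately show False using psubset_card_mono[OF pair_finite_verts] by (metis less_irrefl)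
  qed
qed

text \<open>A cut of \<open>S\<close> is pulled back to \<open>insert v S\<close> by putting
  \<open>v\<close> on the side of \<open>u\<close>; the edge crossing it is then not the contracted
  one and survives.\<close>

lemma conn_contract_edge:
  assumes "conn (parcs G) (insert v S)" "u \<in> S" "S \<subseteq> pverts G - {v}"
  shows "conn (parcs (contract_edge G u v)) S"
proof (rule conn_if_edges_out)
  show "S \<noteq> {}" using assms by blast
  fix Y assume Y: "Y \<subseteq> S" "Y \<noteq> {}" "Y \<noteq> S"
  let ?Y = "if u \<in> Y then insert v Y else Y"
  obtain y z where yz: "y \<in> Y" "z \<in> S" "z \<notin> Y" using Y by blast
  then have "y \<in> ?Y" "y \<in> insert v S" "z \<in> insert v S" "z \<notin> ?Y" using Y assms by auto
  then obtain a b where ab: "a \<in> ?Y" "b \<in> insert v S" "b \<notin> ?Y" "(a, b) \<in> parcs G"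
    using conn_edge_out[OF assms(1)] by metis
  let ?h = "\<lambda>x. if x = v then u else x"
  have "?h a \<in> Y" "?h b \<in> S - Y" using ab assms Y(1) by (auto split: if_splits)
  moreover have "(?h a, ?h b) \<in> parcs (contract_edge G u v)"
    using ab assms Y by (auto simp: contract_edge_def split: if_splits)
  ultimately show "\<exists>a\<in>Y. \<exists>b\<in>S - Y. (a, b) \<in> parcs (contract_edge G u v)" by blast
qed

text \<open>If \<open>{u, v}\<close> does not separate the graph, contraction preserves
  2-connectivity. If it does, both sides are attached to both \<open>u\<close> and \<open>v\<close>,
  so the edge is bypassed on either side. Four vertices let the contraction retain three.\<close>

lemma two_connected_contract_or_delete:
  assumes tc: "two_connected G" and card: "4 \<le> card (pverts G)"
  shows "two_connected (contract_edge G u v) \<or> two_connected (delete_edge G u v)"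
proof -
  let ?V = "pverts G" and ?E = "parcs G"
  have c: "conn ?E ?V" "\<And>x. x \<in> ?V \<Longrightarrow> conn ?E (?V - {x})"
    using tc by (auto simp: two_connected_iff)
  have pv: "pverts (contract_edge G u v) = ?V - {v}" "pverts (delete_edge G u v) = ?V"
    by (simp_all add: contract_edge_def delete_edge_def)
  show ?thesis
  proof (cases "conn ?E (?V - {u, v})")
    case True
    let ?F = "parcs (contract_edge G u v)"
    have "conn ?F (?V - {v})"
      using conn_contract_edge[of "?V - {v}"] c(1) edge_facts by (simp add: insert_absorb)
    moreover have "conn ?F (?V - {v} - {x})" if "x \<in> ?V - {v}" for x
    proof (cases "x = u")
      case True
      have "?V - {v} - {u} = ?V - {u, v}" by blast
      then show ?thesis using \<open>conn ?E (?V - {u, v})\<close> conn_mono[of ?E "?V - {u, v}" ?F]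
        unfolding True by (auto simp: contract_edge_def)
    next
      case False
      have "insert v (?V - {v} - {x}) = ?V - {x}" using that edge_facts by blast
      then show ?thesis using conn_contract_edge[of "?V - {v} - {x}"] c(2) edge_facts that False by auto
    qed
    moreover have "3 \<le> card (?V - {v})" using card edge_facts by simp
    ultimately show ?thesis using pair_graph_contract_edge by (auto simp: two_connected_iff pv)
  next
    case False
    let ?S = "?V - {u, v}"
    have "?S \<noteq> {}"
    proof
      assume "?S = {}"
      then have "?V \<subseteq> {u, v}" by blast
      then have "card ?V \<le> card {u, v}" by (intro card_mono) auto
      then show False using card edge_facts by simp
    qed
    then obtain Y where Y: "Y \<subseteq> ?S" "Y \<noteq> {}" "Y \<noteq> ?S" "\<And>x y. x \<in> Y \<Longrightarrow> y \<in> ?S - Y \<Longrightarrow> (x, y) \<notin> ?E"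
      using conn_if_edges_out[of ?S ?E] False by blast
    have K: "conn (?E - {(u, v), (v, u)}) W"
      if W: "conn ?E W" "W \<subseteq> ?V" "u \<in> W" "v \<in> W" and K: "K = Y \<or> K = ?S - Y" "K \<subseteq> W" for W K
    proof (rule conn_delete_edge[of _ _ ?V _ _ K])
      show "K \<noteq> {}" "u \<notin> K" "v \<notin> K" using K Y by auto
      show "y \<in> K \<union> {u, v}" if xy: "x \<in> K" "(x, y) \<in> ?E" for x y
      proof -
        have "y \<in> ?V" "(y, x) \<in> ?E" using xy in_arcsD2 sym_parcs by (auto dest: symD)
        then show ?thesis using K(1) Y(1,4) xy by blast
      qed
    qed (use W K c edge_facts sym_parcs in auto)
    have "conn (?E - {(u, v), (v, u)}) ?V" using K[of ?V Y] c(1) edge_facts Y by auto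
    moreover have "conn (?E - {(u, v), (v, u)}) (?V - {x})" if "x \<in> ?V" for x
    proof (cases "x \<in> {u, v}")
      case True
      show ?thesis by (rule conn_mono[OF c(2)[OF that]]) (use True in auto)
    next
      case False
      show ?thesis
      \<comment> \<open>The side that does not contain the deleted \<open>x\<close> stays intact and
        serves as the detour.\<close>
      proof (cases "x \<in> Y")
        case True
        show ?thesis by (rule K[of _ "?S - Y"]) (use True that c(2) False edge_facts in auto)
      next
        case xY: False
        show ?thesis by (rule K[of _ Y]) (use xY that c(2) False edge_facts Y in auto)
      qed
    qed
    ultimately show ?thesis using pair_graph_delete_edge card
      by (auto simp: two_connected_iff pv) (simp_all add: delete_edge_def)
  qed
qed

end

lemma minor_minimal_imp_spanning_sdtree:
  fixes G :: "'a pair_pre_digraph"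
  assumes mm: "minor_minimal_2conn_subdiv_Gamma k G" and k: "1 \<le> k"
  obtains C rt ht where "sdtree (pverts G) C rt ht" "ht rt = k" "C \<subseteq> parcs G"
proof -
  have tc: "two_connected G" and sd: "contains_subdivision G (Gamma k)"
    and min: "\<And>H :: 'a pair_pre_digraph. proper_minor_of H G \<Longrightarrow> two_connected H \<Longrightarrow> \<not> contains_subdivision H (Gamma k)"
    using mm unfolding minor_minimal_2conn_subdiv_Gamma_def by blast+
  have G: "pair_graph G" using tc by (simp add: two_connected_iff)
  interpret pair_graph G by (rule G)
  obtain H C rt ht where H: "sdtree (pverts H) C rt ht" "ht rt = k" "parcs H = C \<union> C\<inverse>"
    "subgraph (with_proj H) (with_proj G)"
    and sub: "\<And>G' :: 'a pair_pre_digraph. subgraph (with_proj H) (with_proj G') \<Longrightarrow> contains_subdivision G' (Gamma k)"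
    using contains_subdivision_Gamma_imp_sdtree[OF sd] by blast
  interpret T: sdtree "pverts H" C rt ht by (rule H(1))
  have HG: "pverts H \<subseteq> pverts G" "parcs H \<subseteq> parcs G" and wfH: "pair_wf_digraph H"
    using H(4) by (auto simp: subgraph_def wf_digraph_wp_iff)
  have HV: "x \<in> pverts H" "y \<in> pverts H" if "(x, y) \<in> parcs H" for x y
    using that T.C_sub H(3) by auto
  have "pverts H = pverts G"
  proof (rule ccontr)
    assume "pverts H \<noteq> pverts G"
    then obtain v where v: "v \<in> pverts G" "v \<notin> pverts H" using HG by blast
    \<comment> \<open>This gives a branching vertex with two children; with the uncovered
      \<open>v\<close> there are four vertices, as contracting or deleting an edge requires.\<close>
    have "ht rt = Suc (k - 1)" using H k by simp
    then obtain f b c where fbc: "(rt, f) \<in> C\<^sup>*" "b \<noteq> c" "C `` {f} = {b, c}"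
      using T.branch_below T.rt_in by metis
    have "(f, b) \<in> C" "(f, c) \<in> C" using fbc(3) by (metis Image_singleton_iff insertCI)+
    then have 4: "card {v, f, b, c} = 4" "{v, f, b, c} \<subseteq> pverts G"
      using T.child_neq T.C_sub v HG fbc(2) by (auto simp: card_insert_if)
    then have card: "4 \<le> card (pverts G)" using card_mono[OF pair_finite_verts] by metis
    have "f \<in> pverts G" "f \<noteq> v" using \<open>(f, b) \<in> C\<close> T.C_sub HG v by auto
    moreover have "conn (parcs G) (pverts G)" using tc by (simp add: two_connected_iff)
    ultimately obtain a u where "a \<in> {v}" "(a, u) \<in> parcs G"
      using conn_edge_out[of "parcs G" "pverts G" v "{v}" f] v by (metis singletonD singletonI)
    then have uv: "(u, v) \<in> parcs G" using sym_parcs[OF G] by (auto dest: symD)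
    have "subgraph (with_proj H) (with_proj (contract_edge G u v))"
      using HG HV v pair_graph_contract_edge[OF G uv] wfH
      by (intro subgraph_pairI) (auto simp: contract_edge_def pair_graph_def pair_digraph_def pair_fin_digraph_def)
    moreover have "subgraph (with_proj H) (with_proj (delete_edge G u v))"
      using HG HV v pair_graph_delete_edge[OF G uv] wfH
      by (intro subgraph_pairI) (auto simp: delete_edge_def pair_graph_def pair_digraph_def pair_fin_digraph_def)
    ultimately show False
      using two_connected_contract_or_delete[OF G uv tc card] min sub
        contract_edge_proper_minor[OF G uv] delete_edge_proper_minor[OF G uv] by blast
  qed
  then show ?thesis using that[of C rt ht] H HG by auto
qed


section \<open>The minor \<open>\<Gamma>\<^sub>l\<^sup>+\<close>\<close>

locale spanning_sdtree = sdtree "pverts G" C rt ht for G :: "'a pair_pre_digraph" and C rt ht +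
  assumes tc: "two_connected G" and C_arcs: "C \<subseteq> parcs G"
begin

abbreviation V :: "'a set" where "V \<equiv> pverts G"
abbreviation E :: "('a \<times> 'a) set" where "E \<equiv> parcs G"

lemma graph_G: "pair_graph G"
  using tc by (simp add: two_connected_iff)

lemma sym_E: "(x, y) \<in> E \<Longrightarrow> (y, x) \<in> E"
  using sym_parcs[OF graph_G] by (rule symD)

lemma E_in_V: "(x, y) \<in> E \<Longrightarrow> x \<in> V" "(x, y) \<in> E \<Longrightarrow> y \<in> V"
proof -
  interpret pair_graph G by (rule graph_G)
  show "(x, y) \<in> E \<Longrightarrow> x \<in> V" "(x, y) \<in> E \<Longrightarrow> y \<in> V" by (auto dest: in_arcsD1 in_arcsD2)
qed

lemma C_in_E: "(x, y) \<in> C \<Longrightarrow> (x, y) \<in> E"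
  using C_arcs by blast

lemma conn_minus: "w \<in> V \<Longrightarrow> conn E (V - {w})"
  using tc by (simp add: two_connected_iff)

lemma child_in_V: "(x, y) \<in> C \<Longrightarrow> x \<in> V" "(x, y) \<in> C \<Longrightarrow> y \<in> V"
  using C_sub by blast+

lemma ht_child:
  assumes "(u, v) \<in> C"
  shows "ht v \<le> ht u"
proof -
  have "v \<in> C `` {u}" using assms by blast
  with child_in_V(1)[OF assms] show ?thesis by (cases rule: ht_casesE) auto
qed

lemma ht_mono: "(u, v) \<in> C\<^sup>* \<Longrightarrow> ht v \<le> ht u"
  by (induction rule: rtrancl_induct) (auto dest: ht_child)

lemma ht_siblings:
  assumes "(p, a) \<in> C" "(p, c) \<in> C"
  shows "ht a = ht c"
proof -
  have "a \<in> C `` {p}" "c \<in> C `` {p}" using assms by blast+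
  with child_in_V(1)[OF assms(1)] show ?thesis by (cases rule: ht_casesE) auto
qed

lemma at_most_two_children:
  assumes "(p, a) \<in> C" "(p, b) \<in> C" "(p, c) \<in> C" "a \<noteq> b"
  shows "c = a \<or> c = b"
proof -
  have "a \<in> C `` {p}" "b \<in> C `` {p}" "c \<in> C `` {p}" using assms by blast+
  with child_in_V(1)[OF assms(1)] show ?thesis using assms(4) by (cases rule: ht_casesE) auto
qed

text \<open>Closure under parents keeps the whole tree path from \<open>v\<close> to a member of
  \<open>S\<close> inside \<open>S\<close>.\<close>

lemma conn_upclosed:
  assumes "v \<in> S" "S \<subseteq> sub v" "\<And>p z. z \<in> S \<Longrightarrow> z \<noteq> v \<Longrightarrow> (p, z) \<in> C \<Longrightarrow> p \<in> S"
  shows "conn E S"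
proof (rule conn_if_hub)
  show "v \<in> S" by fact
  show "sym E" using sym_E by (auto intro: symI)
  fix x assume x: "x \<in> S"
  then have "(v, x) \<in> C\<^sup>*" using assms by blast
  then have "x \<in> S \<longrightarrow> (v, x) \<in> (E \<inter> S \<times> S)\<^sup>*"
  proof (induction rule: rtrancl_induct)
    case (step y z)
    show ?case
    proof
      assume z: "z \<in> S"
      have "z \<noteq> v" using step child_not_above by blast
      then have "y \<in> S" using assms(3) z step by blast
      then show "(v, z) \<in> (E \<inter> S \<times> S)\<^sup>*"
        using step z C_in_E by (auto intro: rtrancl.rtrancl_into_rtrancl)
    qed
  qed simp
  with x show "(v, x) \<in> (E \<inter> S \<times> S)\<^sup>*" by blast
qed

lemma Gamma_plus_minor:
  assumes b: "b \<in> V" "b \<noteq> rt" "l \<le> ht b"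
    and exits: "\<And>z. (b, z) \<in> C\<^sup>* \<Longrightarrow> ht b - l \<le> ht z \<Longrightarrow>
      \<exists>u t. (z, u) \<in> C\<^sup>* \<and> (b, t) \<notin> C\<^sup>* \<and> (u, t) \<in> E"
  shows "minor_of (Gamma_plus l) G"
proof -
  \<comment> \<open>For a \<open>v\<close> of positive height, \<open>g\<close> names the two
    children of the branching vertex that ends the chain starting at \<open>v\<close>.\<close>
  have "\<exists>g. v \<in> V \<longrightarrow> 0 < ht v \<longrightarrow> g True \<noteq> g False \<and>
      (\<exists>f. (v, f) \<in> C\<^sup>* \<and> ht f = ht v \<and> (\<forall>x. (f, g x) \<in> C \<and> ht (g x) = ht v - 1))" for v
  proof (cases "v \<in> V \<and> 0 < ht v")
    case True
    then have "v \<in> V" "ht v = Suc (ht v - 1)" by auto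
    then obtain f b c where f: "(v, f) \<in> C\<^sup>*" "ht f = Suc (ht v - 1)" "b \<noteq> c" "C `` {f} = {b, c}"
      "ht b = ht v - 1" "ht c = ht v - 1" by (rule branch_below)
    have "(f, b) \<in> C" "(f, c) \<in> C" using f(4) by (metis Image_singleton_iff insertCI)+
    then show ?thesis using f True
      by (intro exI[of _ "\<lambda>x. if x then b else c"]) (auto intro!: exI[of _ f])
  qed blast
  then obtain g where "\<forall>v. v \<in> V \<longrightarrow> 0 < ht v \<longrightarrow> g v True \<noteq> g v False \<and>
      (\<exists>f. (v, f) \<in> C\<^sup>* \<and> ht f = ht v \<and> (\<forall>x. (f, g v x) \<in> C \<and> ht (g v x) = ht v - 1))"
    using choice[of "\<lambda>v g. v \<in> V \<longrightarrow> 0 < ht v \<longrightarrow> g True \<noteq> g False \<and>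
      (\<exists>f. (v, f) \<in> C\<^sup>* \<and> ht f = ht v \<and> (\<forall>x. (f, g x) \<in> C \<and> ht (g x) = ht v - 1))"] by blast
  then have g: "g v True \<noteq> g v False"
      "\<exists>f. (v, f) \<in> C\<^sup>* \<and> ht f = ht v \<and> (\<forall>x. (f, g v x) \<in> C \<and> ht (g v x) = ht v - 1)"
    if "v \<in> V" "0 < ht v" for v using that by blast+
  \<comment> \<open>Strings grow at the front, so the last letter is the first turn taken from
    \<open>b\<close>; hence \<open>foldr\<close>.\<close>
  define node where "node w = foldr (\<lambda>x v. g v x) w b" for w
  have node_Nil: "node [] = b" and node_Cons: "node (x # w) = g (node w) x" for x w
    by (simp_all add: node_def)
  have node: "(b, node w) \<in> C\<^sup>* \<and> ht (node w) = ht b - length w" if "length w \<le> l" for w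
    using that
  proof (induction w)
    case (Cons x w)
    then have w: "(b, node w) \<in> C\<^sup>*" "ht (node w) = ht b - length w" by auto
    moreover have "node w \<in> V" "0 < ht (node w)" using w b Cons.prems sub_subset_V by auto
    then obtain f where "(node w, f) \<in> C\<^sup>*" "(f, g (node w) x) \<in> C" "ht (g (node w) x) = ht (node w) - 1"
      using g(2) by blast
    then show ?case using w unfolding node_Cons
      by (meson diff_commute diff_diff_left rtrancl.rtrancl_into_rtrancl rtrancl_trans) (simp add: w)
  qed (simp add: node_Nil)
  have nodeV: "node w \<in> V" if "length w \<le> l" for w
    using node[OF that] b desc_in_V by blast
  have nodef: "\<exists>f. (node w, f) \<in> C\<^sup>* \<and> ht f = ht (node w) \<and> (\<forall>x. (f, node (x # w)) \<in> C)"
    "node (True # w) \<noteq> node (False # w)" if "length w < l" for w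
  proof -
    have "node w \<in> V" "0 < ht (node w)" using that node[of w] nodeV[of w] b by auto
    then show "\<exists>f. (node w, f) \<in> C\<^sup>* \<and> ht f = ht (node w) \<and> (\<forall>x. (f, node (x # w)) \<in> C)"
      "node (True # w) \<noteq> node (False # w)" using g[of "node w"] unfolding node_Cons by blast+
  qed
  have node_sub: "sub (node (x # w)) \<subseteq> sub (node w)" if "length w < l" for x w
    using nodef(1)[OF that] by (metis (no_types, lifting) Image_singleton_iff rtrancl.rtrancl_into_rtrancl rtrancl_trans subsetI)
  have disj_same: "sub (node w) \<inter> sub (node w') = {}"
    if "length w = length w'" "length w \<le> l" "w \<noteq> w'" for w w'
    using that
  proof (induction w w' rule: list_induct2)
    case (Cons x w x' w')
    have len: "length w < l" "length w' < l" using Cons by auto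
    show ?case
    proof (cases "w = w'")
      case True
      then have "node (x # w) \<noteq> node (x' # w')" using nodef(2)[OF len(1)] Cons.prems by (cases x; cases x') auto
      then show ?thesis using nodef(1)[OF len(1)] siblings_disjoint True by blast
    next
      case False
      then show ?thesis using Cons len node_sub[OF len(1)] node_sub[OF len(2)] by fastforce
    qed
  qed simp
  \<comment> \<open>A string shorter than \<open>l\<close> gets the chain from its node to the next
    branching vertex, cut out by constant height. A string of length \<open>l\<close> gets its whole
    subtree, so that an edge leaving \<open>sub b\<close> starts in it.\<close>
  define \<mu> where "\<mu> v = (case v of None \<Rightarrow> V - sub b
    | Some w \<Rightarrow> if length w = l then sub (node w) else {z \<in> sub (node w). ht z = ht (node w)})" for v
  have mu_sub: "\<mu> (Some w) \<subseteq> sub (node w)" for w by (auto simp: \<mu>_def)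
  have node_mu: "node w \<in> \<mu> (Some w)" for w by (auto simp: \<mu>_def)
  have mu_None: "\<mu> None = V - sub b" by (simp add: \<mu>_def)
  have disj: "\<mu> (Some w) \<inter> \<mu> (Some w') = {}" if "w \<noteq> w'" "length w \<le> length w'" "length w' \<le> l" for w w'
  proof (cases "length w = length w'")
    case True
    then show ?thesis using disj_same[of w w'] that mu_sub[of w] mu_sub[of w'] by fastforce
  next
    case False
    \<comment> \<open>Strings of different length are told apart by height;
      \<open>l \<le> ht b\<close> keeps the subtractions from being truncated to the same
      value.\<close>
    have False if z: "z \<in> \<mu> (Some w)" "z \<in> \<mu> (Some w')" for z
    proof -
      have "ht z = ht b - length w" using z(1) False \<open>length w \<le> length w'\<close> \<open>length w' \<le> l\<close> node[of w]
        by (auto simp: \<mu>_def split: if_splits)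
      moreover have "ht z \<le> ht b - length w'"
        using z(2) mu_sub[of w'] ht_mono[of "node w'" z] node[of w'] \<open>length w' \<le> l\<close> by auto
      ultimately show False using False \<open>length w \<le> length w'\<close> \<open>length w' \<le> l\<close> b(3) by linarith
    qed
    then show ?thesis by blast
  qed
  have disj_None: "\<mu> (Some w) \<inter> \<mu> None = {}" if "length w \<le> l" for w
    using mu_sub[of w] node[OF that] by (auto simp: mu_None intro: rtrancl_trans)
  have conn_Some: "conn E (\<mu> (Some w))" for w
  proof (rule conn_upclosed[of "node w"])
    fix p z assume z: "z \<in> \<mu> (Some w)" "z \<noteq> node w" "(p, z) \<in> C"
    then have p: "(node w, p) \<in> C\<^sup>*" using mu_sub[of w] above_parent by blast
    have "ht z \<le> ht p" "ht p \<le> ht (node w)" using ht_mono p z(3) by auto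
    with z p show "p \<in> \<mu> (Some w)" by (auto simp: \<mu>_def split: if_splits)
  qed (use node_mu mu_sub in auto)
  have conn_None: "conn E (\<mu> None)"
  proof (rule conn_upclosed[of rt])
    have "(b, rt) \<notin> C\<^sup>*" using b reach antisym_desc by blast
    then show "rt \<in> \<mu> None" using rt_in by (simp add: mu_None)
    show "\<mu> None \<subseteq> sub rt" using reach by (auto simp: mu_None)
    show "p \<in> \<mu> None" if "z \<in> \<mu> None" "(p, z) \<in> C" for p z
      using that child_in_V(1) by (auto simp: mu_None intro: rtrancl.rtrancl_into_rtrancl)
  qed
  have down: "\<exists>x\<in>\<mu> (Some w). \<exists>y\<in>\<mu> (Some (a # w)). (x, y) \<in> E" if len: "length w < l" for w a
  proof -
    obtain f where "(node w, f) \<in> C\<^sup>*" "ht f = ht (node w)" "(f, node (a # w)) \<in> C"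
      using nodef(1)[OF len] by blast
    moreover from this have "f \<in> \<mu> (Some w)" using len by (simp add: \<mu>_def)
    ultimately show ?thesis using node_mu C_in_E by blast
  qed
  have exit: "\<exists>x\<in>\<mu> (Some w). \<exists>y\<in>\<mu> None. (x, y) \<in> E" if len: "length w = l" for w
  proof -
    obtain u t where ut: "(node w, u) \<in> C\<^sup>*" "(b, t) \<notin> C\<^sup>*" "(u, t) \<in> E"
      using exits[of "node w"] node[of w] len by auto
    then have "u \<in> \<mu> (Some w)" "t \<in> \<mu> None" using len E_in_V by (auto simp: \<mu>_def)
    with ut show ?thesis by blast
  qed
  show ?thesis
    unfolding minor_of_def
  proof (intro conjI exI[of _ \<mu>] ballI impI)
    show "pair_graph (Gamma_plus l)" by (rule pair_graph_Gamma_plus)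
    show "pair_graph G" by (rule graph_G)
  next
    fix v assume v: "v \<in> pverts (Gamma_plus l)"
    then show "\<mu> v \<subseteq> V"
      using mu_sub sub_subset_V[OF nodeV] by (cases v) (fastforce simp: mu_None Gamma_plus_def Gamma_def)+
    show "connected (with_proj G \<restriction> \<mu> v)"
      using conn_Some conn_None by (cases v) (simp_all add: connected_induce_iff_conn[OF graph_G])
  next
    fix u v assume uv: "u \<in> pverts (Gamma_plus l)" "v \<in> pverts (Gamma_plus l)" "u \<noteq> v"
    show "\<mu> u \<inter> \<mu> v = {}"
    proof (cases u)
      case None
      then obtain w where "v = Some w" "length w \<le> l" using uv by (auto simp: Gamma_plus_def Gamma_def)
      then show ?thesis using None disj_None[of w] by blast
    next
      case (Some w)
      then have w: "length w \<le> l" using uv by (auto simp: Gamma_plus_def Gamma_def)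
      show ?thesis
      proof (cases v)
        case None
        then show ?thesis using Some disj_None[OF w] by blast
      next
        case (Some w')
        then have w': "length w' \<le> l" "w \<noteq> w'" using uv \<open>u = Some w\<close> by (auto simp: Gamma_plus_def Gamma_def)
        show ?thesis using disj[of w w'] disj[of w' w] w w' Some \<open>u = Some w\<close> nat_le_linear[of "length w" "length w'"]
          by blast
      qed
    qed
  next
    fix e assume "e \<in> parcs (Gamma_plus l)"
    then consider a w where "e = (Some w, Some (a # w))" "length w < l"
      | a w where "e = (Some (a # w), Some w)" "length w < l"
      | w where "e = (Some w, None)" "length w = l" | w where "e = (None, Some w)" "length w = l"
      by (auto simp: Gamma_plus_def Gamma_def)
    then show "case e of (u, v) \<Rightarrow> \<exists>a\<in>\<mu> u. \<exists>b\<in>\<mu> v. (a, b) \<in> E"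
    proof cases
      case (1 a w)
      then show ?thesis using down[of w a] by simp
    next
      case (2 a w)
      then show ?thesis using down[of w a] sym_E by (simp, blast)
    next
      case (3 w)
      then show ?thesis using exit[of w] by simp
    next
      case (4 w)
      then show ?thesis using exit[of w] sym_E by (simp, blast)
    qed
  qed
qed


text \<open>Deleting \<open>q\<close> leaves \<open>G\<close> connected, so some edge avoiding
  \<open>q\<close> leads out of the subtree of \<open>b\<close> towards \<open>rt\<close>; with
  \<open>q \<noteq> rt\<close> the root survives the deletion.\<close>

lemma sub_exit:
  assumes "(q, b) \<in> C" "q \<noteq> rt"
  obtains u t where "(b, u) \<in> C\<^sup>*" "(u, t) \<in> E" "(b, t) \<notin> C\<^sup>*" "t \<noteq> q"
proof -
  have "b \<in> sub b" "b \<in> V - {q}" "rt \<in> V - {q}" using assms(2) child_in_V[OF assms(1)] child_neq[OF assms(1)] rt_in by auto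
  moreover have "rt \<notin> sub b"
    using assms(1) antisym_desc reach no_parent_rt child_in_V(2) by blast
  ultimately obtain u t where "u \<in> sub b" "u \<in> V - {q}" "t \<in> V - {q}" "t \<notin> sub b" "(u, t) \<in> E"
    by (rule conn_edge_out[OF conn_minus[OF child_in_V(1)[OF assms(1)]]])
  then show ?thesis using that by blast
qed

text \<open>At the arc from \<open>p\<close> to \<open>a\<close>, edges that leave the subtree of
  \<open>b\<close> other than to \<open>q\<close> cease to exist. The last conclusion, on the
  siblings of \<open>a\<close>, is later what keeps \<open>p\<close> from being a separator.\<close>

lemma good_descendant:
  assumes nomin: "\<not> minor_of (Gamma_plus l) G" and qb: "(q, b) \<in> C" "q \<noteq> rt" and lb: "l \<le> ht b"
  obtains p a where "(b, p) \<in> C\<^sup>*" "(p, a) \<in> C" "ht b - l \<le> ht a"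
    "\<And>u t. (a, u) \<in> C\<^sup>* \<Longrightarrow> (u, t) \<in> E \<Longrightarrow> (b, t) \<in> C\<^sup>* \<or> t = q"
    "\<exists>u t. (p, u) \<in> C\<^sup>* \<and> (u, t) \<in> E \<and> (b, t) \<notin> C\<^sup>* \<and> t \<noteq> q"
    "\<And>c. (p, c) \<in> C \<Longrightarrow> c \<noteq> a \<Longrightarrow> \<exists>u t. (c, u) \<in> C\<^sup>* \<and> (u, t) \<in> E \<and> (p, t) \<notin> C\<^sup>*"
proof -
  define D where "D z \<longleftrightarrow> (\<exists>u t. (z, u) \<in> C\<^sup>* \<and> (u, t) \<in> E \<and> (b, t) \<notin> C\<^sup>* \<and> t \<noteq> q)" for z
  have bV: "b \<in> V" "b \<noteq> rt" using qb child_in_V no_parent_rt by auto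
  have Db: "D b" using sub_exit[OF qb] unfolding D_def by metis
  have "\<not> (\<forall>z. (b, z) \<in> C\<^sup>* \<longrightarrow> ht b - l \<le> ht z \<longrightarrow>
      (\<exists>u t. (z, u) \<in> C\<^sup>* \<and> (b, t) \<notin> C\<^sup>* \<and> (u, t) \<in> E))"
    using Gamma_plus_minor[OF bV lb] nomin by blast
  then obtain z where z: "(b, z) \<in> C\<^sup>*" "ht b - l \<le> ht z" "\<not> D z" unfolding D_def by blast
  \<comment> \<open>\<open>D\<close> holds at \<open>b\<close> and fails at \<open>z\<close>, so it
    is lost along some arc of the tree path between them.\<close>
  from z(1) have "D z \<or> (\<exists>p a. (b, p) \<in> C\<^sup>* \<and> (p, a) \<in> C \<and> D p \<and> \<not> D a \<and> (a, z) \<in> C\<^sup>*)"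
  proof (induction rule: rtrancl_induct)
    case base
    show ?case using Db by blast
  next
    case (step y z)
    then show ?case by (meson rtrancl.rtrancl_into_rtrancl rtrancl.rtrancl_refl)
  qed
  then obtain p a where pa: "(b, p) \<in> C\<^sup>*" "(p, a) \<in> C" "D p" "\<not> D a" "(a, z) \<in> C\<^sup>*" using z by blast
  have ht: "ht b - l \<le> ht a" using ht_mono[OF pa(5)] z(2) by simp
  have nD: "(b, t) \<in> C\<^sup>* \<or> t = q" if "\<not> D x" "(x, u) \<in> C\<^sup>*" "(u, t) \<in> E" for x u t
    using that unfolding D_def by blast
  show ?thesis
  proof (cases "\<forall>c. (p, c) \<in> C \<longrightarrow> c \<noteq> a \<longrightarrow> (\<exists>u t. (c, u) \<in> C\<^sup>* \<and> (u, t) \<in> E \<and> (p, t) \<notin> C\<^sup>*)")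
    case True
    show ?thesis
      using that[OF pa(1,2) ht] nD[OF pa(4)] pa(3) True unfolding D_def by blast
  next
    case False
    \<comment> \<open>The offending sibling \<open>c\<close> has all its edges inside
      \<open>sub p\<close>. It takes the place of \<open>a\<close>, and \<open>a\<close> becomes the
      sibling whose exit must be shown.\<close>
    then obtain c where c: "(p, c) \<in> C" "c \<noteq> a"
      "\<And>u t. (c, u) \<in> C\<^sup>* \<Longrightarrow> (u, t) \<in> E \<Longrightarrow> (p, t) \<in> C\<^sup>*" by blast
    have "\<not> D c" using c(3) pa(1) unfolding D_def by (meson rtrancl_trans)
    moreover have "ht b - l \<le> ht c" using ht ht_siblings[OF pa(2) c(1)] by simp
    moreover have "\<exists>u t. (a, u) \<in> C\<^sup>* \<and> (u, t) \<in> E \<and> (p, t) \<notin> C\<^sup>*"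
    proof -
      \<comment> \<open>Without \<open>p\<close>, some edge leaves \<open>sub p - {p}\<close>. It
        cannot start below \<open>c\<close>, and \<open>p\<close> has at most two children, so it
        starts below \<open>a\<close>.\<close>
      have pV: "p \<in> V" using pa child_in_V by blast
      have "(p, rt) \<notin> C\<^sup>*" using antisym_desc[of b rt] reach bV pa(1) by (meson rtrancl_trans)
      then have "a \<in> sub p - {p}" "a \<in> V - {p}" "rt \<in> V - {p}" "rt \<notin> sub p - {p}"
        using pa child_in_V child_neq rt_in by auto
      then obtain u t where ut: "u \<in> sub p - {p}" "u \<in> V - {p}" "t \<in> V - {p}" "t \<notin> sub p - {p}" "(u, t) \<in> E"
        by (rule conn_edge_out[OF conn_minus[OF pV]])
      then obtain c' where c': "(p, c') \<in> C" "(c', u) \<in> C\<^sup>*" using obtain_child[of p u] by blast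
      have "c' = a \<or> c' = c" using at_most_two_children[OF pa(2) c(1) c'(1)] c(2) by blast
      moreover have "c' \<noteq> c" using c(3) c'(2) ut by blast
      ultimately show ?thesis using c'(2) ut by blast
    qed
    moreover have "c' = a \<or> c' = c" if "(p, c') \<in> C" for c'
      using at_most_two_children[OF pa(2) c(1) that] c(2) by blast
    ultimately show ?thesis
      using that[OF pa(1) c(1)] nD[of c] pa(3) unfolding D_def by (metis (no_types, lifting))
  qed
qed

end


section \<open>Ears\<close>

text \<open>
  One step of the construction. The path of the current node starts at \<open>p0\<close>, enters the subtree
  of \<open>a\<close>, descends to \<open>s\<close>, and leaves the subtree from there; the subtrees of \<open>a1\<close> and \<open>a2\<close> are
  reserved for the two children, and the ear of the first child uses the edge from \<open>s1\<close> to \<open>t1\<close>.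
\<close>

locale pear_step = spanning_sdtree +
  fixes p0 a s d d' f b1 b2 p1 a1 p2 a2 s1 t1
  assumes p0a: "(p0, a) \<in> C" and ad: "(a, d) \<in> C\<^sup>*" and ds: "(d, s) \<in> C\<^sup>*"
    and dd': "(d, d') \<in> C" and d's: "(d', s) \<notin> C\<^sup>*"
    and off: "\<And>c u t. (d, c) \<in> C \<Longrightarrow> (c, s) \<notin> C\<^sup>* \<Longrightarrow> (c, u) \<in> C\<^sup>* \<Longrightarrow> (u, t) \<in> E \<Longrightarrow>
      (a, t) \<in> C\<^sup>* \<or> t = p0"
    and d'f: "(d', f) \<in> C\<^sup>*" and fb1: "(f, b1) \<in> C" and fb2: "(f, b2) \<in> C" and b12: "b1 \<noteq> b2"
    and b1p1: "(b1, p1) \<in> C\<^sup>*" and p1a1: "(p1, a1) \<in> C"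
    and a1_within: "\<And>u t. (a1, u) \<in> C\<^sup>* \<Longrightarrow> (u, t) \<in> E \<Longrightarrow> (b1, t) \<in> C\<^sup>* \<or> t = f"
    and p1_exit: "\<exists>u t. (p1, u) \<in> C\<^sup>* \<and> (u, t) \<in> E \<and> (b1, t) \<notin> C\<^sup>* \<and> t \<noteq> f"
    and sibling_exit: "\<And>c. (p1, c) \<in> C \<Longrightarrow> c \<noteq> a1 \<Longrightarrow>
      \<exists>u t. (c, u) \<in> C\<^sup>* \<and> (u, t) \<in> E \<and> (p1, t) \<notin> C\<^sup>*"
    and b2p2: "(b2, p2) \<in> C\<^sup>*" and p2a2: "(p2, a2) \<in> C"
    and a2_within: "\<And>u t. (a2, u) \<in> C\<^sup>* \<Longrightarrow> (u, t) \<in> E \<Longrightarrow> (b2, t) \<in> C\<^sup>* \<or> t = f"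
    and a1s1: "(a1, s1) \<in> C\<^sup>*" and s1t1: "(s1, t1) \<in> E" and t1: "(a1, t1) \<notin> C\<^sup>*" "t1 \<noteq> p1"
begin

text \<open>The tree part of the current node's path; only the end outside \<open>sub a\<close> is
  missing.\<close>

definition spine :: "'a set" where
  "spine = {z. (p0, z) \<in> C\<^sup>* \<and> (z, s) \<in> C\<^sup>*}"

text \<open>Where the two outer parts of the first child's ear may run: \<open>sub a1\<close> is
  left to its middle part, and \<open>sub a2\<close> to the other child.\<close>

definition region :: "'a set" where
  "region = insert p0 (sub a) - sub a1 - sub a2"

lemma chain_facts:
  "(p0, a) \<in> C\<^sup>*" "(a, d') \<in> C\<^sup>*" "(d, d') \<in> C\<^sup>*" "(d', b1) \<in> C\<^sup>*" "(d', b2) \<in> C\<^sup>*" "(b1, a1) \<in> C\<^sup>*" "(b2, a2) \<in> C\<^sup>*"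
  "(d', p1) \<in> C\<^sup>*" "(d', a1) \<in> C\<^sup>*" "(d', a2) \<in> C\<^sup>*" "(d, p1) \<in> C\<^sup>*" "(p0, d) \<in> C\<^sup>*" "(a, f) \<in> C\<^sup>*" "(f, p1) \<in> C\<^sup>*"
proof -
  show 1: "(p0, a) \<in> C\<^sup>*" "(a, d') \<in> C\<^sup>*" "(d, d') \<in> C\<^sup>*" "(d', b1) \<in> C\<^sup>*" "(d', b2) \<in> C\<^sup>*" "(b1, a1) \<in> C\<^sup>*" "(b2, a2) \<in> C\<^sup>*"
    using p0a ad dd' d'f fb1 fb2 b1p1 p1a1 b2p2 p2a2 by (simp_all add: rtrancl.rtrancl_into_rtrancl)
  show 2: "(d', p1) \<in> C\<^sup>*" "(d', a1) \<in> C\<^sup>*" "(d', a2) \<in> C\<^sup>*"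
    using 1 b1p1 by (meson rtrancl_trans)+
  show "(d, p1) \<in> C\<^sup>*" "(p0, d) \<in> C\<^sup>*" "(a, f) \<in> C\<^sup>*"
    using 1 2 ad d'f by (meson rtrancl_trans)+
  show "(f, p1) \<in> C\<^sup>*" using fb1 b1p1 by simp
qed

lemma spine_not_reserved:
  assumes "z \<in> spine"
  shows "(a1, z) \<notin> C\<^sup>*" "(a2, z) \<notin> C\<^sup>*"
  using assms chain_facts d's unfolding spine_def by (blast intro: rtrancl_trans)+

lemma b_disjoint: "(b1, z) \<in> C\<^sup>* \<Longrightarrow> (b2, z) \<notin> C\<^sup>*"
  using siblings_disjoint[OF fb1 fb2 b12] by blast

lemma b1_not_a2: "(b1, z) \<in> C\<^sup>* \<Longrightarrow> (a2, z) \<notin> C\<^sup>*"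
  using b_disjoint chain_facts(7) by (meson rtrancl_trans)

lemma b2_not_a1: "(b2, z) \<in> C\<^sup>* \<Longrightarrow> (a1, z) \<notin> C\<^sup>*"
  using b_disjoint chain_facts(6) by (meson rtrancl_trans)

text \<open>Edges from \<open>sub a2\<close> end in \<open>sub b2\<close> or at \<open>f\<close>,
  and none of these vertices lies in \<open>sub b1\<close>.\<close>

lemma nbr_b1_not_a2:
  assumes "(b1, u) \<in> C\<^sup>*" "(u, t) \<in> E"
  shows "(a2, t) \<notin> C\<^sup>*"
proof
  assume "(a2, t) \<in> C\<^sup>*"
  then have "(b2, u) \<in> C\<^sup>* \<or> u = f" using a2_within sym_E assms by blast
  then show False using b_disjoint assms child_not_above fb1 by blast
qed

lemma f_not_reserved: "(a1, f) \<notin> C\<^sup>*" "(a2, f) \<notin> C\<^sup>*"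
  using child_not_above[OF fb1] child_not_above[OF fb2] chain_facts(6,7) by (meson rtrancl_trans)+

lemma starts_in_region: "p1 \<in> region" "t1 \<in> region"
proof -
  have "(a, p1) \<in> C\<^sup>*" using ad chain_facts by (meson rtrancl_trans)
  then show "p1 \<in> region"
    using child_not_above[OF p1a1] b1_not_a2[OF b1p1] by (auto simp: region_def)
  have 1: "(b1, t1) \<in> C\<^sup>* \<or> t1 = f" using a1_within[OF a1s1 s1t1] .
  moreover have "(a, b1) \<in> C\<^sup>*" using chain_facts by (meson rtrancl_trans)
  ultimately have "(a, t1) \<in> C\<^sup>*" using chain_facts by (meson rtrancl_trans)
  then show "t1 \<in> region"
    using 1 t1 b1_not_a2 f_not_reserved by (auto simp: region_def)
qed

lemma spine_in_region: "spine \<subseteq> region"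
proof
  fix z assume z: "z \<in> spine"
  have "(a, s) \<in> C\<^sup>*" using ad ds by (rule rtrancl_trans)
  then have "(a, z) \<in> C\<^sup>* \<or> (z, a) \<in> C\<^sup>*" using z ancestors_linear unfolding spine_def by blast
  moreover have "z = p0" if "(z, a) \<in> C\<^sup>*" "z \<noteq> a"
    using above_parent[OF that p0a] z antisym_desc unfolding spine_def by blast
  ultimately show "z \<in> region" using spine_not_reserved[OF z] by (auto simp: region_def)
qed

text \<open>This is the hypothesis of the two-path lemma. If the part \<open>K\<close> reached from
  \<open>{p1, t1}\<close> without \<open>w\<close> missed the spine, it would lie entirely below
  \<open>w\<close>. Then \<open>sibling_exit\<close> excludes \<open>w = p1\<close>,
  \<open>p1_exit\<close> excludes any other \<open>w\<close> in \<open>sub b1\<close>, and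
  2-connectivity of \<open>G\<close> excludes a \<open>w\<close> at or above
  \<open>f\<close>.\<close>

lemma not_separated:
  obtains x y p where "x \<in> {p1, t1}" "y \<in> spine" "is_path (E \<inter> region \<times> region) x p y" "w \<notin> set p"
proof -
  let ?F = "E \<inter> (region - {w}) \<times> (region - {w})"
  define K where "K = {v. \<exists>x\<in>{p1, t1} - {w}. (x, v) \<in> ?F\<^sup>*}"
  have startK: "x \<in> K" if "x \<in> {p1, t1}" "x \<noteq> w" for x using that unfolding K_def by blast
  have K_region: "v \<in> region" "v \<noteq> w" if vK: "v \<in> K" for v
  proof -
    obtain x where x: "x \<in> {p1, t1}" "x \<noteq> w" "(x, v) \<in> ?F\<^sup>*" using vK unfolding K_def by blast
    from x(3) have "v \<in> region \<and> v \<noteq> w"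
      by (induction rule: rtrancl_induct) (use x starts_in_region in auto)
    then show "v \<in> region" "v \<noteq> w" by blast+
  qed
  have K_step: "t \<in> K" if "u \<in> K" "(u, t) \<in> E" "t \<in> region" "t \<noteq> w" for u t
  proof -
    have "(u, t) \<in> ?F" using that K_region by blast
    with that(1) show ?thesis unfolding K_def by (blast intro: rtrancl.rtrancl_into_rtrancl)
  qed
  have "K \<inter> spine \<noteq> {}"
  proof
    assume dj: "K \<inter> spine = {}"
    have p0_spine: "p0 \<in> spine" and a_spine: "a \<in> spine" and d_spine: "d \<in> spine"
      using chain_facts ad ds unfolding spine_def by (auto intro: rtrancl_trans)
    have K_a: "(a, v) \<in> C\<^sup>*" "v \<noteq> a" if "v \<in> K" for v
      using K_region[OF that] dj that p0_spine a_spine by (auto simp: region_def)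
    \<comment> \<open>Climbing the tree from \<open>K\<close> stays in \<open>K\<close> unless
      \<open>w\<close> is met: a parent in a reserved subtree would put its child there too.\<close>
    have up: "z \<in> K"
      if v: "v \<in> K" and zv: "(z, v) \<in> C\<^sup>*" "(p0, z) \<in> C\<^sup>*" "\<not> ((z, w) \<in> C\<^sup>* \<and> (w, v) \<in> C\<^sup>*)" for v z
      using zv
    proof (induction rule: converse_rtrancl_induct)
      case base
      show ?case by (rule v)
    next
      case (step y z)
      have "(y, z) \<in> C\<^sup>*" using step(1) by blast
      then have z: "z \<in> K" using step by (meson rtrancl_trans)
      have "(a, y) \<in> C\<^sup>*" using K_a[OF z] above_parent step(1) by metis
      moreover have "y \<noteq> w" using step(1,2,5) by (meson converse_rtrancl_into_rtrancl rtrancl.rtrancl_refl)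
      moreover have "(a1, y) \<notin> C\<^sup>*" "(a2, y) \<notin> C\<^sup>*"
        using K_region(1)[OF z] K_a[OF z] step(1) p0_spine dj z
        by (auto simp: region_def intro: rtrancl.rtrancl_into_rtrancl)
      ultimately show ?case using K_step[OF z] sym_E C_in_E step(1) by (auto simp: region_def)
    qed
    \<comment> \<open>As \<open>K\<close> misses the spine, every tree path from the spine down to
      \<open>K\<close> passes through \<open>w\<close>.\<close>
    have star: "(q, w) \<in> C\<^sup>* \<and> (w, v) \<in> C\<^sup>*" if "v \<in> K" "q \<in> spine" "(q, v) \<in> C\<^sup>*" for v q
      using up[OF that(1,3)] that(2) dj unfolding spine_def by blast
    have w_above: "(w, v) \<in> C\<^sup>*" if "v \<in> K" for v
      using star[OF that p0_spine] K_a[OF that] chain_facts(1) by (meson rtrancl_trans)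
    have down: "z \<in> K"
      if v: "v \<in> K" "(v, w) \<notin> C\<^sup>*" and vz: "(v, z) \<in> C\<^sup>*" "(a1, z) \<notin> C\<^sup>*" "(a2, z) \<notin> C\<^sup>*" for v z
      using vz
    proof (induction rule: rtrancl_induct)
      case base
      show ?case by (rule v)
    next
      case (step y z)
      have y: "y \<in> K" using step by (meson rtrancl.rtrancl_into_rtrancl)
      have "(v, z) \<in> C\<^sup>*" using step by simp
      then have "z \<noteq> w" using v(2) by blast
      moreover have "(a, z) \<in> C\<^sup>*" using K_a[OF y] step(2) by simp
      ultimately show ?case using K_step[OF y] step C_in_E by (auto simp: region_def)
    qed
    have within: "(a, t) \<in> C\<^sup>* \<or> t = p0" if "(d', u) \<in> C\<^sup>*" "(u, t) \<in> E" for u t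
      using off[OF dd' d's that] .
    show False
    proof (cases "w = p1")
      case True
      \<comment> \<open>Now \<open>t1\<close> lies below a child \<open>c\<close> of
        \<open>p1\<close> other than \<open>a1\<close>, and the exit of \<open>c\<close> from
        \<open>sub p1\<close> leads to a member of \<open>K\<close> that is not below
        \<open>w\<close>.\<close>
      have t1K: "t1 \<in> K" using startK True t1 by blast
      then obtain c where c: "(p1, c) \<in> C" "(c, t1) \<in> C\<^sup>*"
        using obtain_child[of p1 t1] w_above[OF t1K] True t1 by blast
      have "c \<noteq> a1" using c t1 by blast
      then obtain u t where ut: "(c, u) \<in> C\<^sup>*" "(u, t) \<in> E" "(p1, t) \<notin> C\<^sup>*" using sibling_exit c by blast
      have p0c: "(p0, c) \<in> C\<^sup>*" using chain_facts c(1) by (meson rtrancl.rtrancl_into_rtrancl rtrancl_trans)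
      have cw: "(c, w) \<notin> C\<^sup>*" using child_not_above[OF c(1)] True by blast
      have cK: "c \<in> K" by (rule up[OF t1K c(2) p0c]) (use cw in blast)
      have b1u: "(b1, u) \<in> C\<^sup>*" using b1p1 c(1) ut(1) by (meson rtrancl.rtrancl_into_rtrancl rtrancl_trans)
      have "(a1, u) \<notin> C\<^sup>*" using siblings_disjoint[OF p1a1 c(1)] \<open>c \<noteq> a1\<close> ut(1) by blast
      then have uK: "u \<in> K" using down[OF cK cw ut(1)] b1_not_a2[OF b1u] by blast
      have "(d', u) \<in> C\<^sup>*" using chain_facts b1u by (meson rtrancl_trans)
      then have "t \<in> region"
        using within ut(2,3) nbr_b1_not_a2[OF b1u ut(2)] p1a1
        by (auto simp: region_def intro: converse_rtrancl_into_rtrancl)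
      moreover have "t \<noteq> w" using ut(3) True by blast
      ultimately have "t \<in> K" using K_step[OF uK ut(2)] by blast
      then show False using w_above ut(3) True by blast
    next
      case wp1: False
      have p1K: "p1 \<in> K" using startK wp1 by blast
      have dw: "(d, w) \<in> C\<^sup>*" and wp: "(w, p1) \<in> C\<^sup>*"
        using star[OF p1K d_spine] chain_facts(11) by blast+
      have p1w: "(p1, w) \<notin> C\<^sup>*" using wp wp1 antisym_desc by blast
      show False
      proof (cases "(b1, w) \<in> C\<^sup>*")
        case True
        \<comment> \<open>An edge from \<open>sub p1\<close> to a vertex outside
          \<open>sub b1\<close> other than \<open>f\<close> cannot start in \<open>sub a1\<close>.
          So it starts in \<open>K\<close> and ends in \<open>K\<close>, although \<open>w\<close>
          in \<open>sub b1\<close> should lie above its end.\<close>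
        obtain u t where ut: "(p1, u) \<in> C\<^sup>*" "(u, t) \<in> E" "(b1, t) \<notin> C\<^sup>*" "t \<noteq> f" using p1_exit by blast
        have b1u: "(b1, u) \<in> C\<^sup>*" using b1p1 ut(1) by (rule rtrancl_trans)
        have "(a1, u) \<notin> C\<^sup>*" using a1_within ut(2-) by blast
        then have uK: "u \<in> K" using down[OF p1K p1w ut(1)] b1_not_a2[OF b1u] by blast
        have "(d', u) \<in> C\<^sup>*" using chain_facts b1u by (meson rtrancl_trans)
        moreover have "(a1, t) \<notin> C\<^sup>*" using ut(3) chain_facts by (meson rtrancl_trans)
        ultimately have "t \<in> region"
          using within ut(2) nbr_b1_not_a2[OF b1u ut(2)] by (auto simp: region_def)
        moreover have "t \<noteq> w" using ut(3) True by blast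
        ultimately have "t \<in> K" using K_step[OF uK ut(2)] by blast
        then show False using w_above True ut(3) by (meson rtrancl_trans)
      next
        case b1w: False
        then have "(w, b1) \<in> C\<^sup>*" "w \<noteq> b1" using ancestors_linear[OF b1p1 wp] by auto
        then have wf: "(w, f) \<in> C\<^sup>*" using above_parent fb1 by blast
        have b2w: "(b2, w) \<notin> C\<^sup>*" using wf child_not_above[OF fb2] by (meson rtrancl_trans)
        \<comment> \<open>Here \<open>w\<close> is at or above \<open>f\<close>, and the cut is
          taken in all of \<open>G\<close> without \<open>w\<close>. Reserved subtrees are added so
          that edges into them do not count as leaving. \<open>sub a2\<close> joins only if
          \<open>K\<close> meets \<open>sub b2\<close>: then \<open>b2\<close> is in
          \<open>K\<close>, and edges leaving \<open>sub a2\<close> end in \<open>K\<close> or at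
          \<open>w\<close>.\<close>
        define Y where "Y = K \<union> sub a1 \<union> (if sub b2 \<inter> K = {} then {} else sub a2)"
        have wV: "w \<in> V" using dw child_in_V[OF dd'] desc_in_V by blast
        have "p0 \<noteq> a" using child_neq[OF p0a] .
        then obtain z where z: "z \<in> spine" "z \<noteq> w" "z \<in> V" using p0_spine a_spine child_in_V[OF p0a] by metis
        have "p1 \<in> Y" "p1 \<in> V - {w}" "z \<in> V - {w}" "z \<notin> Y"
          using p1K wp1 child_in_V[OF p1a1] z spine_not_reserved[OF z(1)] dj
          unfolding Y_def by (auto split: if_splits)
        then obtain u v where uv: "u \<in> Y" "u \<in> V - {w}" "v \<in> V - {w}" "v \<notin> Y" "(u, v) \<in> E"
          by (rule conn_edge_out[OF conn_minus[OF wV]])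
        have p0b: "(p0, b1) \<in> C\<^sup>*" "(p0, b2) \<in> C\<^sup>*" "(p0, f) \<in> C\<^sup>*"
          using chain_facts by (meson rtrancl_trans)+
        have parent_f: "v \<noteq> f" if "b \<in> K" "(f, b) \<in> C" for b
        proof
          assume "v = f"
          then have "(f, w) \<notin> C\<^sup>*" using wf antisym_desc uv(3) by blast
          then have "f \<in> K" using up[OF that(1) r_into_rtrancl[OF that(2)] p0b(3)] by blast
          then show False using uv(4) \<open>v = f\<close> unfolding Y_def by blast
        qed
        consider "u \<in> K" | "u \<in> sub a1" | x where "u \<in> sub a2" "x \<in> sub b2" "x \<in> K"
          using uv(1) unfolding Y_def by (auto split: if_splits)
        then show False
        proof cases
          case 1
          have "(d, u) \<in> C\<^sup>*" using w_above[OF 1] dw by (meson rtrancl_trans)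
          moreover have "d \<noteq> u" using 1 d_spine dj by blast
          ultimately obtain c where c: "(d, c) \<in> C" "(c, u) \<in> C\<^sup>*" by (rule obtain_child)
          \<comment> \<open>If \<open>c\<close> were on the spine, \<open>w\<close> and with it
            \<open>f\<close> would lie below \<open>c\<close>, forcing \<open>c = d'\<close>. So
            \<open>u\<close> is below a child off the spine, and \<open>off\<close> applies.\<close>
          have "(c, s) \<notin> C\<^sup>*"
          proof
            assume cs: "(c, s) \<in> C\<^sup>*"
            have "(p0, c) \<in> C\<^sup>*" using chain_facts(12) c(1) by (rule rtrancl.rtrancl_into_rtrancl)
            then have "c \<in> spine" using cs unfolding spine_def by blast
            then have "(c, w) \<in> C\<^sup>*" using star[OF 1 _ c(2)] by blast
            then have "(c, f) \<in> C\<^sup>*" using wf by (rule rtrancl_trans)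
            then have "c = d'" using siblings_disjoint[OF c(1) dd'] d'f by blast
            then show False using cs d's by blast
          qed
          then have "(a, v) \<in> C\<^sup>* \<or> v = p0" using off[OF c(1) _ c(2) uv(5)] by blast
          moreover have "v \<notin> region" using K_step[OF 1 uv(5)] uv(3,4) unfolding Y_def by blast
          ultimately have v2: "v \<in> sub a2" "sub b2 \<inter> K = {}"
            using uv(4) unfolding Y_def region_def by (auto split: if_splits)
          \<comment> \<open>From outside \<open>sub b2\<close> the subtree \<open>sub a2\<close> is
            entered only from \<open>f\<close>; but with \<open>f\<close> in \<open>K\<close>, also
            \<open>b2\<close> is in \<open>K\<close>.\<close>
          then have "(b2, u) \<in> C\<^sup>* \<or> u = f" using a2_within sym_E[OF uv(5)] by blast
          then have "u = f" using v2 1 by blast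
          then have "(f, w) \<notin> C\<^sup>*" using wf antisym_desc uv(2) by blast
          moreover have "(a2, b2) \<notin> C\<^sup>*"
            using child_not_above[OF p2a2] b2p2 by (meson rtrancl_trans)
          ultimately have "b2 \<in> K"
            using down[of f b2] 1 \<open>u = f\<close> fb2 b2_not_a1[of b2] by blast
          then show False using v2 by blast
        next
          case 2
          have b1K: "b1 \<in> K" by (rule up[OF p1K b1p1 p0b(1)]) (use b1w in blast)
          have "(b1, v) \<in> C\<^sup>* \<or> v = f" using a1_within 2 uv(5) by blast
          then have "(b1, v) \<in> C\<^sup>*" using parent_f[OF b1K fb1] by blast
          then have "v \<in> K" using down[OF b1K b1w] b1_not_a2 uv(4) unfolding Y_def by blast
          then show False using uv(4) unfolding Y_def by blast
        next
          case (3 x)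
          have b2K: "b2 \<in> K" by (rule up[of x, OF 3(3) _ p0b(2)]) (use 3 b2w in blast)+
          then have Y: "sub a2 \<subseteq> Y" unfolding Y_def by auto
          have "(b2, v) \<in> C\<^sup>* \<or> v = f" using a2_within 3 uv(5) by blast
          then have "(b2, v) \<in> C\<^sup>*" using parent_f[OF b2K fb2] by blast
          then have "v \<in> K" using down[OF b2K b2w] b2_not_a1 uv(4) Y by blast
          then show False using uv(4) unfolding Y_def by blast
        qed
      qed
    qed
  qed
  then obtain x y where xy: "x \<in> {p1, t1}" "x \<noteq> w" "y \<in> spine" "(x, y) \<in> ?F\<^sup>*" unfolding K_def by blast
  then obtain p where p: "is_path ?F x p y" using rtrancl_imp_is_path by metis
  have "set p \<subseteq> region - {w}"
    by (rule set_path_subset) (use p xy starts_in_region in \<open>auto simp: is_path_def\<close>)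
  moreover have "is_path (E \<inter> region \<times> region) x p y" using p by (auto simp: is_path_def)
  ultimately show ?thesis using that xy by blast
qed

text \<open>Of two disjoint paths from \<open>{p1, t1}\<close> to the spine, one starts at each
  vertex. Cut at their first spine vertex they meet the spine only in their ends, and they avoid
  \<open>m\<close> because \<open>region\<close> excludes \<open>sub a1\<close>.\<close>

lemma obtain_ear:
  assumes mid: "is_path C a1 m s1" "set m \<subseteq> sub a1"
  obtains L M where "L \<noteq> []" "M \<noteq> []" "last L = p1" "hd M = t1" "distinct (L @ m @ M)"
    "set (vwalk_arcs (L @ m @ M)) \<subseteq> E" "set L \<union> set M \<subseteq> region"
    "hd L \<in> spine" "last M \<in> spine" "(set L \<union> set M) \<inter> spine = {hd L, last M}"
proof -
  let ?F = "E \<inter> region \<times> region"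
  obtain x p y x' p' y' where xy: "x \<in> {p1, t1}" "x' \<in> {p1, t1}" "y \<in> spine" "y' \<in> spine"
    "is_path ?F x p y" "is_path ?F x' p' y'" "set p \<inter> set p' = {}"
    by (rule two_disjoint_paths[of "{p1, t1}" spine ?F]) (use not_separated in metis)
  have "x \<in> set p" "x' \<in> set p'" using xy(5,6) hd_in_set unfolding is_path_def by metis+
  then have "x = p1 \<and> x' = t1 \<or> x = t1 \<and> x' = p1" using xy by blast
  then obtain pp qq yp yq where pq: "is_path ?F p1 pp yp" "is_path ?F t1 qq yq" "set pp \<inter> set qq = {}"
    "yp \<in> spine" "yq \<in> spine" using xy(3-) by (metis inf_commute)
  obtain p y where p: "is_path ?F p1 p y" "y \<in> spine" "set p \<subseteq> set pp" "set p \<inter> spine = {y}"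
    using is_path_first_hit[OF pq(1,4)] by metis
  obtain q z where q: "is_path ?F t1 q z" "z \<in> spine" "set q \<subseteq> set qq" "set q \<inter> spine = {z}"
    using is_path_first_hit[OF pq(2,5)] by metis
  have reg: "set p \<subseteq> region" "set q \<subseteq> region"
    by (rule set_path_subset; use p q starts_in_region in \<open>auto simp: is_path_def\<close>)+
  have "sym ?F" using sym_E by (auto simp: sym_def)
  then have rp: "is_path ?F y (rev p) p1" using p(1) is_path_rev by metis
  have dj: "set p \<inter> set q = {}" "set m \<inter> (set p \<union> set q) = {}"
    using pq(3) p(3) q(3) mid(2) reg unfolding region_def by blast+
  have E: "(p1, a1) \<in> E" "(s1, t1) \<in> E" using C_in_E p1a1 s1t1 by blast+
  show ?thesis
  proof (rule that[of "rev p" q])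
    show "set (vwalk_arcs (rev p @ m @ q)) \<subseteq> E"
      using rp q(1) mid(1) E C_arcs by (auto simp: set_vwalk_arcs_append is_path_def)
  qed (use rp q mid dj reg p in \<open>auto simp: is_path_def\<close>)
qed

end

text \<open>Moving \<open>p1\<close> and \<open>t1\<close> into the middle part exhibits the child's
  path as a segment of its ear, as the containment of the path in the ear requires.\<close>

lemma (in pear_step) obtain_ear_around:
  assumes mid: "is_path C a1 m s1" "set m \<subseteq> sub a1"
  obtains L M where "vpath (L @ (p1 # m @ [t1]) @ M) (with_proj G)"
    "path_ends (L @ (p1 # m @ [t1]) @ M) \<subseteq> spine"
    "set (L @ (p1 # m @ [t1]) @ M) \<subseteq> insert p0 (sub a)"
    "internal_verts (L @ (p1 # m @ [t1]) @ M) \<subseteq> sub a - spine"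
    "set (L @ (p1 # m @ [t1]) @ M) \<inter> sub a1 \<subseteq> set m"
    "set (L @ (p1 # m @ [t1]) @ M) \<inter> sub a2 = {}"
proof -
  obtain L M where LM: "L \<noteq> []" "M \<noteq> []" "last L = p1" "hd M = t1" "distinct (L @ m @ M)"
    "set (vwalk_arcs (L @ m @ M)) \<subseteq> E" "set L \<union> set M \<subseteq> region"
    "hd L \<in> spine" "last M \<in> spine" "(set L \<union> set M) \<inter> spine = {hd L, last M}"
    by (rule obtain_ear[OF mid])
  let ?q = "L @ m @ M"
  have L: "L = butlast L @ [p1]" using LM(1,3) append_butlast_last_id by metis
  have M: "M = t1 # tl M" using LM(2,4) list.collapse by metis
  have q: "?q = butlast L @ (p1 # m @ [t1]) @ tl M" by (subst L, subst M) simp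
  have ends: "path_ends ?q = {hd L, last M}" using LM(1,2) by (simp add: path_ends_def)
  have aV: "insert p0 (sub a) \<subseteq> V" using child_in_V[OF p0a] sub_subset_V by blast
  have m_a: "set m \<subseteq> sub a" using mid(2) chain_facts by (auto intro: rtrancl_trans)
  have reg: "region \<subseteq> insert p0 (sub a)" by (auto simp: region_def)
  have p0: "p0 \<in> spine" using chain_facts(12) ds by (auto simp: spine_def intro: rtrancl_trans)
  have m_spine: "set m \<inter> spine = {}" using mid(2) spine_not_reserved by blast
  have a12: "sub a1 \<inter> sub a2 = {}" using b1_not_a2 chain_facts(6) by (blast intro: rtrancl_trans)
  have "vpath ?q (with_proj G)"
    using LM m_a reg aV by (auto simp: vpath_def vwalk_def)
  moreover have "path_ends ?q \<subseteq> spine" using ends LM by simp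
  moreover have "set ?q \<subseteq> insert p0 (sub a)" using LM(7) m_a reg by auto
  moreover have "internal_verts ?q \<subseteq> sub a - spine"
  proof -
    have "internal_verts ?q \<inter> spine = {}" using LM(10) m_spine unfolding internal_verts_def ends by auto
    moreover have "internal_verts ?q \<subseteq> insert p0 (sub a)"
      using \<open>set ?q \<subseteq> insert p0 (sub a)\<close> unfolding internal_verts_def by blast
    ultimately show ?thesis using p0 by blast
  qed
  moreover have "set ?q \<inter> sub a1 \<subseteq> set m" "set ?q \<inter> sub a2 = {}"
    using LM(7) mid(2) a12 unfolding region_def by auto
  ultimately show ?thesis unfolding q by (rule that)
qed


section \<open>Pear trees\<close>

lemma pair_wf_path_graph: "pair_wf_digraph (path_graph p)"
proof
  have "set (vwalk_arcs p) \<subseteq> set p \<times> set p"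
    by (induction p rule: vwalk_arcs.induct) auto
  then show "fst e \<in> pverts (path_graph p)" "snd e \<in> pverts (path_graph p)" if "e \<in> parcs (path_graph p)" for e
    using that by (auto simp: path_graph_def)
qed

lemma subgraph_path_graph: "subgraph (with_proj (path_graph p)) (with_proj (path_graph (L @ p @ M)))"
proof (rule subgraph_pairI[OF pair_wf_path_graph pair_wf_path_graph])
  show "parcs (path_graph p) \<subseteq> parcs (path_graph (L @ p @ M))"
    by (auto simp: path_graph_def set_vwalk_arcs_append)
qed (auto simp: path_graph_def)

text \<open>Two parents of a vertex, or a parent of the root, would give a second walk from the
  root.\<close>

lemma rooted_tree_imp_rtree:
  assumes "rooted_tree T r"
  shows "rtree (pverts T) (parcs T) r"
proof -
  interpret pair_digraph T using assms by (simp add: rooted_tree_def)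
  have r: "r \<in> pverts T" and uniq: "\<And>v. v \<in> pverts T \<Longrightarrow> \<exists>!p. awalk r p v"
    using assms by (auto simp: rooted_tree_def)
  have ext: "awalk r (p @ [(u, v)]) v" if "awalk r p u" "(u, v) \<in> parcs T" for p u v
    using that by (auto intro: awalk_appendI simp: awalk_simps dest: in_arcsD2)
  show ?thesis
  proof
    show "finite (pverts T)" by simp
    show "parcs T \<subseteq> pverts T \<times> pverts T" by (auto dest: in_arcsD1 in_arcsD2)
    show "r \<in> pverts T" by (rule r)
    show "(r, v) \<in> (parcs T)\<^sup>*" if "v \<in> pverts T" for v
      using uniq[OF that] reachable_awalk[of r v] rtrancl_on_rtranclI[of r v]
      unfolding reachable_def by auto
    show "u = u'" if uv: "(u, v) \<in> parcs T" "(u', v) \<in> parcs T" for u u' v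
    proof -
      obtain p p' where "awalk r p u" "awalk r p' u'" using uniq in_arcsD1 uv by metis
      then have "awalk r (p @ [(u, v)]) v" "awalk r (p' @ [(u', v)]) v" using ext uv by blast+
      then have "p @ [(u, v)] = p' @ [(u', v)]" using uniq in_arcsD2[OF uv(1)] by blast
      then show ?thesis by simp
    qed
    show "(u, r) \<notin> parcs T" for u
    proof
      assume ur: "(u, r) \<in> parcs T"
      then obtain p where "awalk r p u" using uniq in_arcsD1 by metis
      then have "awalk r (p @ [(u, r)]) r" "awalk r [] r" using ext ur r by (auto simp: awalk_simps)
      then show False using uniq[OF r] by blast
    qed
  qed
qed

section \<open>Recursive assembly of the pear tree\<close>

locale pear_search = spanning_sdtree G C rt ht + T: rtree "pverts T" "parcs T" r
  for G :: "'a pair_pre_digraph" and C rt ht and T :: "'t pair_pre_digraph" and r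
begin

abbreviation desc :: "'t \<Rightarrow> 't set" where
  "desc x \<equiv> (parcs T)\<^sup>* `` {x}"

definition pear_path :: "'a \<Rightarrow> 'a list \<Rightarrow> bool" where
  "pear_path a ps \<longleftrightarrow> (\<exists>p m s t. ps = p # m @ [t] \<and> (p, a) \<in> C \<and> is_path C a m s \<and>
     set m = {z. (a, z) \<in> C\<^sup>* \<and> (z, s) \<in> C\<^sup>*} \<and> (s, t) \<in> E \<and> (a, t) \<notin> C\<^sup>* \<and> t \<noteq> p)"

definition path_pair :: "'a list \<Rightarrow> 'a list \<Rightarrow> bool" where
  "path_pair p q \<longleftrightarrow> vpath p (with_proj G) \<and> vpath q (with_proj G) \<and>
     2 \<le> vwalk_length p \<and> 2 \<le> vwalk_length q \<and>
     subgraph (with_proj (path_graph p)) (with_proj (path_graph q))"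

text \<open>
  The part of a clean pear tree below \<open>x\<close>, with \<open>Q x\<close> left open: all ears below \<open>x\<close> live in the
  subtree of \<open>a\<close>, so any ear through \<open>P x\<close> that otherwise avoids this subtree can serve as \<open>Q x\<close>.
\<close>

definition subpear :: "'t \<Rightarrow> 'a \<Rightarrow> ('t \<Rightarrow> 'a list) \<Rightarrow> ('t \<Rightarrow> 'a list) \<Rightarrow> bool" where
  "subpear x a P Q \<longleftrightarrow> pear_path a (P x) \<and>
     (\<forall>z \<in> desc x - {x}. path_pair (P z) (Q z) \<and> (\<forall>p. (p, a) \<in> C \<longrightarrow> set (Q z) \<subseteq> insert p (sub a)) \<and>
        internal_verts (Q z) \<subseteq> sub a - set (P x)) \<and>
     (\<forall>y \<in> desc x. \<forall>z. (y, z) \<in> parcs T \<longrightarrow> ear G (set (P y)) (Q z) \<and>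
        (\<forall>z'. (y, z') \<in> parcs T \<longrightarrow> z' \<noteq> z \<longrightarrow> internal_verts (P z) \<inter> set (Q z') = {} \<and>
          (\<forall>v \<in> desc x - {x} - (desc z \<union> desc z'). internal_verts (Q z) \<inter> set (Q v) = {}))) \<and>
     (\<forall>y \<in> desc x. children T y \<noteq> {} \<longrightarrow>
        (\<exists>e \<in> path_ends (P y). \<forall>z \<in> children T y. e \<notin> set (Q z)))"

lemma subpear_path: "subpear x a P Q \<Longrightarrow> pear_path a (P x)"
  unfolding subpear_def by (elim conjE)

lemma subpear_clean:
  assumes "subpear x a P Q" "y \<in> desc x" "children T y \<noteq> {}"
  shows "\<exists>e \<in> path_ends (P y). \<forall>z \<in> children T y. e \<notin> set (Q z)"
proof -
  have "\<forall>y \<in> desc x. children T y \<noteq> {} \<longrightarrow>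
      (\<exists>e \<in> path_ends (P y). \<forall>z \<in> children T y. e \<notin> set (Q z))"
    using assms(1) unfolding subpear_def by (elim conjE)
  then show ?thesis using assms(2,3) by blast
qed

lemma pear_path_vpath:
  assumes "pear_path a ps"
  shows "vpath ps (with_proj G)" "2 \<le> vwalk_length ps" "internal_verts ps \<subseteq> sub a"
proof -
  obtain p m s t where ps: "ps = p # m @ [t]" and pa: "(p, a) \<in> C" and m: "is_path C a m s"
    "set m = {z. (a, z) \<in> C\<^sup>* \<and> (z, s) \<in> C\<^sup>*}" and st: "(s, t) \<in> E" "(a, t) \<notin> C\<^sup>*" "t \<noteq> p"
    using assms unfolding pear_path_def by blast
  have "m \<noteq> []" "hd m = a" "last m = s" "distinct m" "set (vwalk_arcs m) \<subseteq> C" using m(1) by (auto simp: is_path_def)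
  then have "set (vwalk_arcs ps) \<subseteq> E" "distinct ps"
    using m(2) pa st C_in_E child_not_above[OF pa] by (auto simp: ps set_vwalk_arcs_append)
  moreover have "set ps \<subseteq> V"
    using m(2) child_in_V[OF pa] desc_in_V E_in_V(2)[OF st(1)] by (auto simp: ps)
  ultimately show "vpath ps (with_proj G)" by (auto simp: vpath_def vwalk_def ps)
  show "2 \<le> vwalk_length ps" using \<open>m \<noteq> []\<close> by (cases m) (auto simp: ps)
  show "internal_verts ps \<subseteq> sub a" using m(2) by (auto simp: internal_verts_def path_ends_def ps)
qed

lemma desc_child:
  assumes "(x, y) \<in> parcs T"
  shows "desc y \<subseteq> desc x - {x}"
  using T.child_not_above[OF assms] assms by (auto intro: converse_rtrancl_into_rtrancl)

lemma desc_children: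
  assumes "children T x = {x1, x2}"
  shows "desc x - {x} = desc x1 \<union> desc x2"
proof -
  have ch: "(x, x1) \<in> parcs T" "(x, x2) \<in> parcs T" "\<And>c. (x, c) \<in> parcs T \<Longrightarrow> c = x1 \<or> c = x2"
    using assms unfolding children_def by auto
  have "desc x - {x} \<subseteq> desc x1 \<union> desc x2"
    using ch(3) T.obtain_child[of x] by blast
  then show ?thesis using desc_child ch by blast
qed

text \<open>Entries outside \<open>desc x\<close>, and \<open>Q\<close> at \<open>x\<close>, do not
  occur in \<open>subpear\<close>. This allows the families of two siblings to be glued and the
  siblings' own ears to be set afterwards.\<close>

lemma subpear_cong:
  assumes "subpear x a P Q" "\<And>z. z \<in> desc x \<Longrightarrow> P z = P' z" "\<And>z. z \<in> desc x - {x} \<Longrightarrow> Q z = Q' z"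
  shows "subpear x a P' Q'"
proof -
  have x: "x \<in> desc x" by blast
  have ch: "z \<in> desc x - {x}" if "y \<in> desc x" "(y, z) \<in> parcs T" for y z
    using that desc_child by (auto dest: T.child_not_above intro: rtrancl.rtrancl_into_rtrancl)
  have P: "P z = P' z" and Q: "Q z = Q' z" if "y \<in> desc x" "(y, z) \<in> parcs T" for y z
    using ch[OF that] assms(2,3) by auto
  show ?thesis
    unfolding subpear_def
  proof (intro conjI ballI allI impI)
    show "pear_path a (P' x)" using assms(1) assms(2)[OF x] by (simp add: subpear_def)
  next
    fix z assume z: "z \<in> desc x - {x}"
    then have "P z = P' z" "Q z = Q' z" using assms(2,3) by auto
    then show "path_pair (P' z) (Q' z)" "\<And>p. (p, a) \<in> C \<Longrightarrow> set (Q' z) \<subseteq> insert p (sub a)"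
      "internal_verts (Q' z) \<subseteq> sub a - set (P' x)"
      using assms(1) z assms(2)[OF x] unfolding subpear_def by metis+
  next
    fix y z assume yz: "y \<in> desc x" "(y, z) \<in> parcs T"
    then show "ear G (set (P' y)) (Q' z)"
      using assms(1) Q[OF yz] assms(2)[OF yz(1)] unfolding subpear_def by metis
    fix z' assume z': "(y, z') \<in> parcs T" "z' \<noteq> z"
    then show "internal_verts (P' z) \<inter> set (Q' z') = {}"
      using assms(1) P[OF yz] Q[OF yz(1) z'(1)] yz unfolding subpear_def by metis
    fix v assume v: "v \<in> desc x - {x} - (desc z \<union> desc z')"
    then have "Q v = Q' v" using assms(3) by blast
    then show "internal_verts (Q' z) \<inter> set (Q' v) = {}"
      using assms(1) Q[OF yz] yz z' v unfolding subpear_def by metis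
  next
    fix y assume y: "y \<in> desc x" "children T y \<noteq> {}"
    then obtain e where "e \<in> path_ends (P y)" "\<forall>z\<in>children T y. e \<notin> set (Q z)"
      using subpear_clean[OF assms(1)] by metis
    then show "\<exists>e\<in>path_ends (P' y). \<forall>z\<in>children T y. e \<notin> set (Q' z)"
      using Q[OF y(1)] assms(2)[OF y(1)] unfolding children_def by auto
  qed
qed

text \<open>
  Here \<open>p\<close> is the path of a node, \<open>p'\<close> and \<open>q\<close> are the path and the ear of its child with the
  reserved subtree of \<open>a1\<close>, and the subtree of \<open>a2\<close> is reserved for the other child.
\<close>

definition ear_fits :: "'a \<Rightarrow> 'a list \<Rightarrow> 'a \<Rightarrow> 'a \<Rightarrow> 'a list \<Rightarrow> 'a list \<Rightarrow> bool" where
  "ear_fits a p a1 a2 p' q \<longleftrightarrow> path_pair p' q \<and> (\<forall>p0. (p0, a) \<in> C \<longrightarrow> set q \<subseteq> insert p0 (sub a)) \<and>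
     internal_verts q \<subseteq> sub a - set p \<and> ear G (set p) q \<and> set q \<inter> sub a1 \<subseteq> set p' \<and>
     set q \<inter> sub a2 = {} \<and> (\<exists>p1. (p1, a1) \<in> C \<and> (a, p1) \<in> C\<^sup>* \<and> (a2, p1) \<notin> C\<^sup>*) \<and>
     sub a1 \<inter> set p = {} \<and> sub a1 \<inter> sub a2 = {}"

text \<open>Ears strictly below a child have their internal vertices in its reserved subtree, off
  its path. There the child's own ear only follows that path, and ears of the other side do not
  enter, so all disjointness requirements survive the union.\<close>

lemma subpear_combine:
  assumes ch: "children T x = {x1, x2}" "x1 \<noteq> x2"
    and S: "subpear x1 a1 P Q" "subpear x2 a2 P Q"
    and px: "pear_path a (P x)"
    and fits: "ear_fits a (P x) a1 a2 (P x1) (Q x1)" "ear_fits a (P x) a2 a1 (P x2) (Q x2)"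
  shows "subpear x a P Q"
proof -
  have xc: "(x, x1) \<in> parcs T" "(x, x2) \<in> parcs T" "\<And>c. (x, c) \<in> parcs T \<Longrightarrow> c = x1 \<or> c = x2"
    using ch(1) unfolding children_def by auto
  note D = desc_children[OF ch(1)]
  \<comment> \<open>One side of the claim, used for both children by symmetry. Compared with
    \<open>subpear\<close> it adds disjointness from the child's own ear and from all ears of the
    other side.\<close>
  have side: "(\<forall>z \<in> desc u - {u}. path_pair (P z) (Q z) \<and>
        (\<forall>p. (p, a) \<in> C \<longrightarrow> set (Q z) \<subseteq> insert p (sub a)) \<and> internal_verts (Q z) \<subseteq> sub a - set (P x)) \<and>
     (\<forall>y \<in> desc u. \<forall>z. (y, z) \<in> parcs T \<longrightarrow> ear G (set (P y)) (Q z) \<and>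
        (\<forall>z'. (y, z') \<in> parcs T \<longrightarrow> z' \<noteq> z \<longrightarrow> internal_verts (P z) \<inter> set (Q z') = {} \<and>
          (\<forall>v \<in> (desc u \<union> desc u') - (desc z \<union> desc z'). internal_verts (Q z) \<inter> set (Q v) = {})))"
    if S: "subpear u b P Q" and S': "subpear u' b' P Q"
      and fits: "ear_fits a (P x) b b' (P u) (Q u)" and fits': "ear_fits a (P x) b' b (P u') (Q u')"
    for u u' b b'
  proof -
    obtain p1 where p1: "(p1, b) \<in> C" "(a, p1) \<in> C\<^sup>*" using fits unfolding ear_fits_def by blast
    obtain p2 where p2: "(p2, b') \<in> C" "(b, p2) \<notin> C\<^sup>*" using fits' unfolding ear_fits_def by blast
    have ba: "sub b \<subseteq> sub a" using p1 by (auto intro: rtrancl_trans)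
    have bx: "sub b \<inter> set (P x) = {}" "sub b \<inter> sub b' = {}"
      and qu: "set (Q u) \<inter> sub b \<subseteq> set (P u)" and qu': "set (Q u') \<inter> sub b = {}"
      using fits fits' unfolding ear_fits_def by blast+
    have below: "path_pair (P z) (Q z)" "set (Q z) \<subseteq> insert p1 (sub b)"
       "internal_verts (Q z) \<subseteq> sub b - set (P u)" if "z \<in> desc u - {u}" for z
      using S that p1(1) unfolding subpear_def by blast+
    \<comment> \<open>Ears strictly below \<open>u'\<close> stay in \<open>sub b'\<close> and the
      parent \<open>p2\<close> of \<open>b'\<close>, and \<open>p2\<close> is not in
      \<open>sub b\<close>.\<close>
    have below': "set (Q z) \<inter> sub b = {}" if "z \<in> desc u'" for z
    proof (cases "z = u'")
      case False
      then have "set (Q z) \<subseteq> insert p2 (sub b')" using S' that p2(1) unfolding subpear_def by blast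
      then show ?thesis using p2(2) bx(2) by blast
    qed (use qu' in simp)
    have zu: "z \<in> desc u - {u}" if "y \<in> desc u" "(y, z) \<in> parcs T" for y z
      using that by (auto dest: T.child_not_above intro: rtrancl.rtrancl_into_rtrancl)
    show ?thesis
    proof (intro conjI ballI allI impI)
      fix z assume z: "z \<in> desc u - {u}"
      show "path_pair (P z) (Q z)" by (rule below[OF z])
      show "set (Q z) \<subseteq> insert p (sub a)" for p using below(2)[OF z] ba p1(2) by blast
      show "internal_verts (Q z) \<subseteq> sub a - set (P x)" using below(3)[OF z] ba bx(1) by blast
    next
      fix y z assume yz: "y \<in> desc u" "(y, z) \<in> parcs T"
      then show "ear G (set (P y)) (Q z)" using S unfolding subpear_def by blast
      fix z' assume z': "(y, z') \<in> parcs T" "z' \<noteq> z"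
      then show "internal_verts (P z) \<inter> set (Q z') = {}" using S yz unfolding subpear_def by blast
      fix v assume v: "v \<in> (desc u \<union> desc u') - (desc z \<union> desc z')"
      note iz = below(3)[OF zu[OF yz]]
      consider "v = u" | "v \<in> desc u'" | "v \<in> desc u - {u} - (desc z \<union> desc z')" using v by blast
      then show "internal_verts (Q z) \<inter> set (Q v) = {}"
      proof cases
        case 1
        then show ?thesis using iz qu by blast
      next
        case 2
        then show ?thesis using iz below' by blast
      next
        case 3
        then show ?thesis using S yz z' unfolding subpear_def by blast
      qed
    qed
  qed
  note s1 = side[OF S fits] and s2 = side[OF S(2,1) fits(2,1)]
  have int: "internal_verts (P x1) \<inter> set (Q x2) = {}" "internal_verts (P x2) \<inter> set (Q x1) = {}"
  proof -
    have ab: "set (Q x1) \<inter> sub a2 = {}" "set (Q x2) \<inter> sub a1 = {}"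
      using fits by (simp_all add: ear_fits_def)
    have "internal_verts (P x1) \<subseteq> sub a1" "internal_verts (P x2) \<subseteq> sub a2"
      using pear_path_vpath(3)[OF subpear_path] S by metis+
    then show "internal_verts (P x1) \<inter> set (Q x2) = {}" "internal_verts (P x2) \<inter> set (Q x1) = {}"
      using ab by blast+
  qed
  have Dx: "desc x = insert x (desc x1 \<union> desc x2)" using D by blast
  show ?thesis
    unfolding subpear_def
  proof (intro conjI)
    show "pear_path a (P x)" by (rule px)
    show "\<forall>z \<in> desc x - {x}. path_pair (P z) (Q z) \<and> (\<forall>p. (p, a) \<in> C \<longrightarrow> set (Q z) \<subseteq> insert p (sub a)) \<and>
        internal_verts (Q z) \<subseteq> sub a - set (P x)"
    proof
      fix z assume "z \<in> desc x - {x}"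
      then consider "z = x1" | "z = x2" | "z \<in> desc x1 - {x1}" | "z \<in> desc x2 - {x2}" unfolding D by blast
      then show "path_pair (P z) (Q z) \<and> (\<forall>p. (p, a) \<in> C \<longrightarrow> set (Q z) \<subseteq> insert p (sub a)) \<and>
        internal_verts (Q z) \<subseteq> sub a - set (P x)"
        by cases (use fits s1 s2 in \<open>auto simp: ear_fits_def\<close>)
    qed
    show "\<forall>y \<in> desc x. \<forall>z. (y, z) \<in> parcs T \<longrightarrow> ear G (set (P y)) (Q z) \<and>
        (\<forall>z'. (y, z') \<in> parcs T \<longrightarrow> z' \<noteq> z \<longrightarrow> internal_verts (P z) \<inter> set (Q z') = {} \<and>
          (\<forall>v \<in> desc x - {x} - (desc z \<union> desc z'). internal_verts (Q z) \<inter> set (Q v) = {}))"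
    proof
      fix y assume "y \<in> desc x"
      then consider "y = x" | "y \<in> desc x1" | "y \<in> desc x2" unfolding Dx by blast
      then show "\<forall>z. (y, z) \<in> parcs T \<longrightarrow> ear G (set (P y)) (Q z) \<and>
        (\<forall>z'. (y, z') \<in> parcs T \<longrightarrow> z' \<noteq> z \<longrightarrow> internal_verts (P z) \<inter> set (Q z') = {} \<and>
          (\<forall>v \<in> desc x - {x} - (desc z \<union> desc z'). internal_verts (Q z) \<inter> set (Q v) = {}))"
        unfolding D
      proof cases
        case 1
        show "\<forall>z. (y, z) \<in> parcs T \<longrightarrow> ear G (set (P y)) (Q z) \<and>
          (\<forall>z'. (y, z') \<in> parcs T \<longrightarrow> z' \<noteq> z \<longrightarrow> internal_verts (P z) \<inter> set (Q z') = {} \<and>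
            (\<forall>v \<in> desc x1 \<union> desc x2 - (desc z \<union> desc z'). internal_verts (Q z) \<inter> set (Q v) = {}))"
        proof (intro allI impI conjI ballI)
          fix z assume "(y, z) \<in> parcs T"
          then have z: "z = x1 \<or> z = x2" using xc(3) 1 by blast
          then show "ear G (set (P y)) (Q z)" using fits 1 by (auto simp: ear_fits_def)
          fix z' assume "(y, z') \<in> parcs T" "z' \<noteq> z"
          then have z': "z = x1 \<and> z' = x2 \<or> z = x2 \<and> z' = x1" using xc(3) 1 z by blast
          then show "internal_verts (P z) \<inter> set (Q z') = {}" using int by blast
          fix v assume "v \<in> desc x1 \<union> desc x2 - (desc z \<union> desc z')"
          then show "internal_verts (Q z) \<inter> set (Q v) = {}" using z' by blast
        qed
      next
        case 2
        then show "\<forall>z. (y, z) \<in> parcs T \<longrightarrow> ear G (set (P y)) (Q z) \<and>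
          (\<forall>z'. (y, z') \<in> parcs T \<longrightarrow> z' \<noteq> z \<longrightarrow> internal_verts (P z) \<inter> set (Q z') = {} \<and>
            (\<forall>v \<in> desc x1 \<union> desc x2 - (desc z \<union> desc z'). internal_verts (Q z) \<inter> set (Q v) = {}))"
          using s1 by metis
      next
        case 3
        then show "\<forall>z. (y, z) \<in> parcs T \<longrightarrow> ear G (set (P y)) (Q z) \<and>
          (\<forall>z'. (y, z') \<in> parcs T \<longrightarrow> z' \<noteq> z \<longrightarrow> internal_verts (P z) \<inter> set (Q z') = {} \<and>
            (\<forall>v \<in> desc x1 \<union> desc x2 - (desc z \<union> desc z'). internal_verts (Q z) \<inter> set (Q v) = {}))"
          using s2 by (metis sup_commute)
      qed
    qed
    show "\<forall>y \<in> desc x. children T y \<noteq> {} \<longrightarrow>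
        (\<exists>e \<in> path_ends (P y). \<forall>z \<in> children T y. e \<notin> set (Q z))"
    proof (intro ballI impI)
      fix y assume y: "y \<in> desc x" "children T y \<noteq> {}"
      show "\<exists>e \<in> path_ends (P y). \<forall>z \<in> children T y. e \<notin> set (Q z)"
      proof (cases "y = x")
        case True
        obtain p m s t where ps: "P x = p # m @ [t]" "(p, a) \<in> C" "(a, t) \<notin> C\<^sup>*" "t \<noteq> p"
          using px unfolding pear_path_def by blast
        have "set (Q x1) \<subseteq> insert p (sub a)" "set (Q x2) \<subseteq> insert p (sub a)"
          using fits ps(2) by (simp_all add: ear_fits_def)
        then have "t \<notin> set (Q x1)" "t \<notin> set (Q x2)" using ps(3,4) by blast+
        then show ?thesis using ch(1) ps(1) True by (intro bexI[of _ t]) (auto simp: path_ends_def)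
      next
        case False
        then have "y \<in> desc x1 \<or> y \<in> desc x2" using y Dx by blast
        then show ?thesis using subpear_clean[OF S(1) _ y(2)] subpear_clean[OF S(2) _ y(2)] by metis
      qed
    qed
  qed
qed

end

text \<open>The step facts are provided for every choice of the edge leaving \<open>sub a1\<close>
  or \<open>sub a2\<close>, since that edge belongs to a path which only the recursion determines.
  Swapping the indices serves the second child.\<close>

lemma (in spanning_sdtree) obtain_step:
  assumes nomin: "\<not> minor_of (Gamma_plus l) G" and p0a: "(p0, a) \<in> C" "p0 \<noteq> rt"
    and ht: "2 * l + 1 \<le> ht a"
  obtains s t d d' f b1 b2 p1 a1 p2 a2 where "(a, s) \<in> C\<^sup>*" "(s, t) \<in> E" "(a, t) \<notin> C\<^sup>*" "t \<noteq> p0"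
    "(p1, a1) \<in> C" "p1 \<noteq> rt" "(p2, a2) \<in> C" "p2 \<noteq> rt"
    "ht a - (2 * l + 1) \<le> ht a1" "ht a - (2 * l + 1) \<le> ht a2"
    "\<And>s1 t1. (a1, s1) \<in> C\<^sup>* \<Longrightarrow> (s1, t1) \<in> E \<Longrightarrow> (a1, t1) \<notin> C\<^sup>* \<Longrightarrow> t1 \<noteq> p1 \<Longrightarrow>
      pear_step G C rt ht p0 a s d d' f b1 b2 p1 a1 p2 a2 s1 t1"
    "\<And>s2 t2. (a2, s2) \<in> C\<^sup>* \<Longrightarrow> (s2, t2) \<in> E \<Longrightarrow> (a2, t2) \<notin> C\<^sup>* \<Longrightarrow> t2 \<noteq> p2 \<Longrightarrow>
      pear_step G C rt ht p0 a s d d' f b2 b1 p2 a2 p1 a1 s2 t2"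
proof -
  have not_rt: "z \<noteq> rt" if "(x, z) \<in> C\<^sup>*" "(y, x) \<in> C" for x y z
    using that no_parent_rt antisym_desc reach child_in_V(2) by blast
  have "l \<le> ht a" using ht by simp
  then obtain d d' where d: "(a, d) \<in> C\<^sup>*" "(d, d') \<in> C" "ht a - l \<le> ht d'"
    and d'_within: "\<And>u t. (d', u) \<in> C\<^sup>* \<Longrightarrow> (u, t) \<in> E \<Longrightarrow> (a, t) \<in> C\<^sup>* \<or> t = p0"
    and d_exit: "\<exists>u t. (d, u) \<in> C\<^sup>* \<and> (u, t) \<in> E \<and> (a, t) \<notin> C\<^sup>* \<and> t \<noteq> p0"
    by (rule good_descendant[OF nomin p0a]) blast
  define X where "X = {u. (d, u) \<in> C\<^sup>* \<and> (\<exists>t. (u, t) \<in> E \<and> (a, t) \<notin> C\<^sup>* \<and> t \<noteq> p0)}"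
  \<comment> \<open>The transitive closure makes \<open>s\<close> a lowest exit: no proper
    descendant of \<open>s\<close> has one. This yields \<open>off\<close> when the path stops at
    \<open>d\<close> itself.\<close>
  have wf: "wf ((C\<inverse>)\<^sup>+)" using wf_converse by (rule wf_trancl)
  obtain x where "x \<in> X" using d_exit unfolding X_def by blast
  then obtain s where s: "s \<in> X" "\<And>y. (y, s) \<in> (C\<inverse>)\<^sup>+ \<Longrightarrow> y \<notin> X" using wfE_min[OF wf] by metis
  have ds: "(d, s) \<in> C\<^sup>*" using s(1) unfolding X_def by blast
  obtain t where t: "(s, t) \<in> E" "(a, t) \<notin> C\<^sup>*" "t \<noteq> p0" using s(1) unfolding X_def by blast
  have d's: "(d', s) \<notin> C\<^sup>*" using d'_within t by blast
  have off: "(a, t') \<in> C\<^sup>* \<or> t' = p0"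
    if c: "(d, c) \<in> C" "(c, s) \<notin> C\<^sup>*" and u: "(c, u) \<in> C\<^sup>*" "(u, t') \<in> E" for c u t'
  proof (cases "c = d'")
    case True
    then show ?thesis using d'_within u by blast
  next
    case False
    \<comment> \<open>Otherwise the path would enter a child of \<open>d\<close> other than
      \<open>d'\<close> and \<open>c\<close>, since neither lies above \<open>s\<close>; but
      \<open>d\<close> has at most two children.\<close>
    have "s = d"
    proof (rule ccontr)
      assume "s \<noteq> d"
      then obtain c' where "(d, c') \<in> C" "(c', s) \<in> C\<^sup>*" using obtain_child[OF ds] by blast
      then show False using at_most_two_children[OF d(2) c(1)] False c(2) d's by blast
    qed
    then have "(s, u) \<in> C\<^sup>+" using c(1) u(1) by (meson rtrancl_into_trancl2)
    then have "u \<notin> X" using s(2) by (simp add: trancl_converse)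
    moreover have "(d, u) \<in> C\<^sup>*" using c(1) u(1) by (rule converse_rtrancl_into_rtrancl)
    ultimately show ?thesis using u(2) unfolding X_def by blast
  qed
  have "d' \<in> V" "ht d' = Suc (ht d' - 1)" using child_in_V[OF d(2)] d(3) ht by auto
  then obtain f b1 b2 where f: "(d', f) \<in> C\<^sup>*" "ht f = Suc (ht d' - 1)" "b1 \<noteq> b2" "C `` {f} = {b1, b2}"
    "ht b1 = ht d' - 1" "ht b2 = ht d' - 1" by (rule branch_below)
  have fb: "(f, b1) \<in> C" "(f, b2) \<in> C" using f(4) by (metis Image_singleton_iff insertCI)+
  have f_rt: "f \<noteq> rt" using not_rt[OF f(1) d(2)] .
  have lb: "l \<le> ht b1" "l \<le> ht b2" using f(5,6) d(3) ht by auto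
  obtain p1 a1 where 1: "(b1, p1) \<in> C\<^sup>*" "(p1, a1) \<in> C" "ht b1 - l \<le> ht a1"
    "\<And>u t. (a1, u) \<in> C\<^sup>* \<Longrightarrow> (u, t) \<in> E \<Longrightarrow> (b1, t) \<in> C\<^sup>* \<or> t = f"
    "\<exists>u t. (p1, u) \<in> C\<^sup>* \<and> (u, t) \<in> E \<and> (b1, t) \<notin> C\<^sup>* \<and> t \<noteq> f"
    "\<And>c. (p1, c) \<in> C \<Longrightarrow> c \<noteq> a1 \<Longrightarrow> \<exists>u t. (c, u) \<in> C\<^sup>* \<and> (u, t) \<in> E \<and> (p1, t) \<notin> C\<^sup>*"
    by (rule good_descendant[OF nomin fb(1) f_rt lb(1)]) blast
  obtain p2 a2 where 2: "(b2, p2) \<in> C\<^sup>*" "(p2, a2) \<in> C" "ht b2 - l \<le> ht a2"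
    "\<And>u t. (a2, u) \<in> C\<^sup>* \<Longrightarrow> (u, t) \<in> E \<Longrightarrow> (b2, t) \<in> C\<^sup>* \<or> t = f"
    "\<exists>u t. (p2, u) \<in> C\<^sup>* \<and> (u, t) \<in> E \<and> (b2, t) \<notin> C\<^sup>* \<and> t \<noteq> f"
    "\<And>c. (p2, c) \<in> C \<Longrightarrow> c \<noteq> a2 \<Longrightarrow> \<exists>u t. (c, u) \<in> C\<^sup>* \<and> (u, t) \<in> E \<and> (p2, t) \<notin> C\<^sup>*"
    by (rule good_descendant[OF nomin fb(2) f_rt lb(2)]) blast
  show ?thesis
  proof (rule that[of s t p1 a1 p2 a2 d d' f b1 b2])
    show "(a, s) \<in> C\<^sup>*" using d(1) ds by (rule rtrancl_trans)
    show "p1 \<noteq> rt" "p2 \<noteq> rt" using not_rt 1(1) 2(1) fb by blast+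
    show "ht a - (2 * l + 1) \<le> ht a1" "ht a - (2 * l + 1) \<le> ht a2" using 1(3) 2(3) f(5,6) d(3) by linarith+
    show "pear_step G C rt ht p0 a s d d' f b1 b2 p1 a1 p2 a2 s1 t1"
      if "(a1, s1) \<in> C\<^sup>*" "(s1, t1) \<in> E" "(a1, t1) \<notin> C\<^sup>*" "t1 \<noteq> p1" for s1 t1
      by unfold_locales (fact p0a d ds d's off f fb 1 2 that)+
    show "pear_step G C rt ht p0 a s d d' f b2 b1 p2 a2 p1 a1 s2 t2"
      if "(a2, s2) \<in> C\<^sup>*" "(s2, t2) \<in> E" "(a2, t2) \<notin> C\<^sup>*" "t2 \<noteq> p2" for s2 t2
      by unfold_locales (fact p0a d ds d's off f f(3)[symmetric] fb 1 2 that)+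
  qed (fact t 1 2)+
qed

context pear_search
begin

lemma pear_path_exists:
  assumes "(p, a) \<in> C" "(a, s) \<in> C\<^sup>*" "(s, t) \<in> E" "(a, t) \<notin> C\<^sup>*" "t \<noteq> p"
  obtains m where "pear_path a (p # m @ [t])" "set m = {z. (a, z) \<in> C\<^sup>* \<and> (z, s) \<in> C\<^sup>*}"
  using tree_path[OF assms(2)] assms unfolding pear_path_def by metis

text \<open>The spine together with \<open>t\<close> is the path of the node. As \<open>t\<close>
  lies outside \<open>insert p0 (sub a)\<close>, the ear found for the spine is an ear of the whole
  path.\<close>

lemma ear_fits_exists:
  assumes "pear_step G C rt ht p0 a s d d' f b1 b2 p1 a1 p2 a2 s1 t1"
    and m: "set m = {z. (a, z) \<in> C\<^sup>* \<and> (z, s) \<in> C\<^sup>*}" and t: "(a, t) \<notin> C\<^sup>*" "t \<noteq> p0"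
    and m1: "pear_path a1 (p1 # m1 @ [t1])" "is_path C a1 m1 s1" "set m1 \<subseteq> sub a1"
  obtains q where "ear_fits a (p0 # m @ [t]) a1 a2 (p1 # m1 @ [t1]) q"
proof -
  interpret S: pear_step G C rt ht p0 a s d d' f b1 b2 p1 a1 p2 a2 s1 t1 by fact
  obtain L M where LM: "vpath (L @ (p1 # m1 @ [t1]) @ M) (with_proj G)"
    "path_ends (L @ (p1 # m1 @ [t1]) @ M) \<subseteq> S.spine"
    "set (L @ (p1 # m1 @ [t1]) @ M) \<subseteq> insert p0 (sub a)"
    "internal_verts (L @ (p1 # m1 @ [t1]) @ M) \<subseteq> sub a - S.spine"
    "set (L @ (p1 # m1 @ [t1]) @ M) \<inter> sub a1 \<subseteq> set m1"
    "set (L @ (p1 # m1 @ [t1]) @ M) \<inter> sub a2 = {}"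
    by (rule S.obtain_ear_around[OF m1(2,3)])
  define p' q where "p' = p1 # m1 @ [t1]" and "q = L @ p' @ M"
  note LM = LM[folded p'_def, folded q_def]
  have spine: "S.spine = insert p0 (set m)"
  proof
    show "S.spine \<subseteq> insert p0 (set m)"
      using S.spine_in_region unfolding S.region_def m S.spine_def by blast
    have "(a, s) \<in> C\<^sup>*" using S.ad S.ds by (rule rtrancl_trans)
    then show "insert p0 (set m) \<subseteq> S.spine"
      using S.chain_facts(1) unfolding S.spine_def m by (auto intro: rtrancl_trans)
  qed
  then have Px: "set (p0 # m @ [t]) = insert t S.spine" by auto
  have a1a: "sub a1 \<subseteq> sub a" using S.chain_facts by (auto intro: rtrancl_trans)
  have "path_pair p' q"
    using pear_path_vpath[OF m1(1), folded p'_def] LM(1) subgraph_path_graph[of p' L M]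
    unfolding path_pair_def q_def by auto
  moreover have "set q \<subseteq> insert p (sub a)" if "(p, a) \<in> C" for p
    using LM(3) parent_unique[OF that S.p0a] by simp
  moreover have int: "internal_verts q \<subseteq> sub a - set (p0 # m @ [t])" using LM(4) t(1) unfolding Px by blast
  moreover have "ear G (set (p0 # m @ [t])) q"
    using LM(1,2) int unfolding ear_def Px by blast
  moreover have "set q \<inter> sub a1 \<subseteq> set p'" using LM(5) unfolding p'_def by auto
  moreover have "(a, p1) \<in> C\<^sup>*" using S.chain_facts by (meson rtrancl_trans)
  moreover have "sub a1 \<inter> set (p0 # m @ [t]) = {}"
    using S.spine_not_reserved(1) a1a t(1) unfolding Px by blast
  moreover have "sub a1 \<inter> sub a2 = {}" using S.b1_not_a2 S.chain_facts(6) by (blast intro: rtrancl_trans)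
  ultimately have "ear_fits a (p0 # m @ [t]) a1 a2 p' q"
    unfolding ear_fits_def using LM(6) S.p1a1 S.b1_not_a2[OF S.b1p1] by blast
  then show ?thesis using that unfolding p'_def by blast
qed

lemma subpear_leaf:
  assumes "children T x = {}" "pear_path a ps"
  shows "subpear x a (\<lambda>_. ps) Q"
proof -
  have "(x, y) \<notin> parcs T" for y using assms(1) unfolding children_def by blast
  then have "desc x = {x}" by (auto elim: converse_rtranclE)
  then show ?thesis using assms \<open>\<And>y. (x, y) \<notin> parcs T\<close> unfolding subpear_def by simp
qed

text \<open>\<open>n\<close> bounds the height of \<open>T\<close> below \<open>x\<close>, and each
  level consumes \<open>2 * l + 1\<close> of the height available at \<open>a\<close>. At a leaf,
  any edge leaving \<open>sub a\<close> other than to \<open>p0\<close> completes the path.\<close>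

lemma subpear_exists:
  assumes nomin: "\<not> minor_of (Gamma_plus l) G"
    and full: "\<And>x. x \<in> pverts T \<Longrightarrow> children T x \<noteq> {} \<Longrightarrow> card (children T x) = 2"
  shows "x \<in> pverts T \<Longrightarrow> (\<And>j y. (x, y) \<in> parcs T ^^ j \<Longrightarrow> j \<le> n) \<Longrightarrow> (p0, a) \<in> C \<Longrightarrow> p0 \<noteq> rt \<Longrightarrow>
    (2 * l + 1) * n \<le> ht a \<Longrightarrow> \<exists>P Q. subpear x a P Q"
proof (induction n arbitrary: x p0 a)
  case 0
  have "children T x = {}"
  proof (rule ccontr)
    assume "children T x \<noteq> {}"
    then obtain y where "(x, y) \<in> parcs T" unfolding children_def by blast
    then have "(x, y) \<in> parcs T ^^ 1" by simp
    then show False using "0.prems"(2) by fastforce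
  qed
  moreover obtain s t where "(a, s) \<in> C\<^sup>*" "(s, t) \<in> E" "(a, t) \<notin> C\<^sup>*" "t \<noteq> p0"
    using sub_exit[OF "0.prems"(3,4)] by metis
  then obtain m where "pear_path a (p0 # m @ [t])" using pear_path_exists[OF "0.prems"(3)] by metis
  ultimately show ?case using subpear_leaf by blast
next
  case (Suc n)
  have "2 * l + 1 \<le> ht a" using Suc.prems(5) by simp
  then obtain s t d d' f b1 b2 p1 a1 p2 a2 where st: "(a, s) \<in> C\<^sup>*" "(s, t) \<in> E" "(a, t) \<notin> C\<^sup>*" "t \<noteq> p0"
    and pa: "(p1, a1) \<in> C" "p1 \<noteq> rt" "(p2, a2) \<in> C" "p2 \<noteq> rt"
    and hta: "ht a - (2 * l + 1) \<le> ht a1" "ht a - (2 * l + 1) \<le> ht a2"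
    and step1: "\<And>s1 t1. (a1, s1) \<in> C\<^sup>* \<Longrightarrow> (s1, t1) \<in> E \<Longrightarrow> (a1, t1) \<notin> C\<^sup>* \<Longrightarrow> t1 \<noteq> p1 \<Longrightarrow>
      pear_step G C rt ht p0 a s d d' f b1 b2 p1 a1 p2 a2 s1 t1"
    and step2: "\<And>s2 t2. (a2, s2) \<in> C\<^sup>* \<Longrightarrow> (s2, t2) \<in> E \<Longrightarrow> (a2, t2) \<notin> C\<^sup>* \<Longrightarrow> t2 \<noteq> p2 \<Longrightarrow>
      pear_step G C rt ht p0 a s d d' f b2 b1 p2 a2 p1 a1 s2 t2"
    by (rule obtain_step[OF nomin Suc.prems(3,4)]) blast
  obtain m where m: "pear_path a (p0 # m @ [t])" "set m = {z. (a, z) \<in> C\<^sup>* \<and> (z, s) \<in> C\<^sup>*}"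
    using pear_path_exists[OF Suc.prems(3) st] by metis
  show ?case
  proof (cases "children T x = {}")
    case True
    then show ?thesis using subpear_leaf m(1) by blast
  next
    case False
    then have "card (children T x) = 2" using full Suc.prems(1) by blast
    then obtain x1 x2 where ch: "children T x = {x1, x2}" "x1 \<noteq> x2" by (meson card_2_iff)
    then have xc: "(x, x1) \<in> parcs T" "(x, x2) \<in> parcs T" unfolding children_def by auto
    have sub_n: "j \<le> n" if "(x, c) \<in> parcs T" "(c, y) \<in> parcs T ^^ j" for c y j
    proof -
      have "(x, y) \<in> parcs T ^^ Suc j" using relpow_Suc_I2[OF that] .
      then show ?thesis using Suc.prems(2) by fastforce
    qed
    have V: "x1 \<in> pverts T" "x2 \<in> pverts T" using xc T.C_sub by auto
    have hn: "(2 * l + 1) * n \<le> ht a1" "(2 * l + 1) * n \<le> ht a2" using hta Suc.prems(5) by simp_all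
    have "\<exists>P Q. subpear x1 a1 P Q"
      by (rule Suc.IH[OF V(1) _ pa(1,2) hn(1)]) (rule sub_n[OF xc(1)])
    then obtain P1 Q1 where S1: "subpear x1 a1 P1 Q1" by blast
    have "\<exists>P Q. subpear x2 a2 P Q"
      by (rule Suc.IH[OF V(2) _ pa(3,4) hn(2)]) (rule sub_n[OF xc(2)])
    then obtain P2 Q2 where S2: "subpear x2 a2 P2 Q2" by blast
    \<comment> \<open>The ears come after the recursive calls, because the edge from
      \<open>s1\<close> to \<open>t1\<close> that an ear must use is read off from the child's
      path.\<close>
    have ear: "\<exists>q. ear_fits a (p0 # m @ [t]) b b' pb q"
      if pb: "pear_path b pb" and qb: "(q, b) \<in> C"
        and step: "\<And>s1 t1. (b, s1) \<in> C\<^sup>* \<Longrightarrow> (s1, t1) \<in> E \<Longrightarrow> (b, t1) \<notin> C\<^sup>* \<Longrightarrow> t1 \<noteq> q \<Longrightarrow>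
          pear_step G C rt ht p0 a s d d' f c c' q b q' b' s1 t1" for b b' pb q q' c c'
    proof -
      obtain q1 m1 s1 t1 where pb': "pb = q1 # m1 @ [t1]" "(q1, b) \<in> C" "is_path C b m1 s1"
        "set m1 = {z. (b, z) \<in> C\<^sup>* \<and> (z, s1) \<in> C\<^sup>*}" "(s1, t1) \<in> E" "(b, t1) \<notin> C\<^sup>*" "t1 \<noteq> q1"
        using pb unfolding pear_path_def by blast
      have "q1 = q" using parent_unique[OF pb'(2) qb] .
      have "s1 \<in> set m1" using pb'(3) last_in_set unfolding is_path_def by metis
      then have "(b, s1) \<in> C\<^sup>*" using pb'(4) by blast
      then have "pear_step G C rt ht p0 a s d d' f c c' q b q' b' s1 t1"
        using step pb'(5,6,7) \<open>q1 = q\<close> by blast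
      then show ?thesis
        using ear_fits_exists[OF _ m(2) st(3,4), of d d' f c c' q b q' b' s1 t1 m1] pb pb' \<open>q1 = q\<close> by auto
    qed
    obtain q1 where q1: "ear_fits a (p0 # m @ [t]) a1 a2 (P1 x1) q1"
      using ear[OF subpear_path[OF S1] pa(1) step1] by blast
    obtain q2 where q2: "ear_fits a (p0 # m @ [t]) a2 a1 (P2 x2) q2"
      using ear[OF subpear_path[OF S2] pa(3) step2] by blast
    \<comment> \<open>Disjointness of the two descendant sets makes the gluing consistent;
      \<open>Q\<close> at \<open>x\<close> itself gets an arbitrary value, to be set one level
      higher.\<close>
    define P where "P z = (if z = x then p0 # m @ [t] else if z \<in> desc x1 then P1 z else P2 z)" for z
    define Q where "Q z = (if z = x1 then q1 else if z = x2 then q2 else if z \<in> desc x1 then Q1 z else Q2 z)" for z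
    have dj: "desc x1 \<inter> desc x2 = {}" using T.siblings_disjoint[OF xc ch(2)] .
    have nx: "x \<notin> desc x1" "x \<notin> desc x2" using desc_child xc by blast+
    have xi: "x1 \<in> desc x1" "x2 \<in> desc x2" by blast+
    have S1': "subpear x1 a1 P Q"
      by (rule subpear_cong[OF S1]) (use dj nx xi in \<open>auto simp: P_def Q_def\<close>)
    have S2': "subpear x2 a2 P Q"
      by (rule subpear_cong[OF S2]) (use dj nx xi in \<open>auto simp: P_def Q_def\<close>)
    have "P x = p0 # m @ [t]" "P x1 = P1 x1" "P x2 = P2 x2" "Q x1 = q1" "Q x2 = q2"
      using dj nx xi ch(2) by (auto simp: P_def Q_def)
    then have "subpear x a P Q"
      using subpear_combine[OF ch S1' S2'] m(1) q1 q2 by simp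
    then show ?thesis by blast
  qed
qed

end

text \<open>\<open>tree_height\<close> is a maximum over leaves, so the walk to \<open>y\<close> is
  extended to a lowest descendant of \<open>y\<close>, which is a leaf.\<close>

lemma rooted_tree_height_bound:
  assumes "rooted_tree T r" "(r, y) \<in> parcs T ^^ j"
  shows "j \<le> tree_height T r"
proof -
  interpret pair_digraph T using assms by (simp add: rooted_tree_def)
  interpret R: rtree "pverts T" "parcs T" r using rooted_tree_imp_rtree[OF assms(1)] .
  have walk: "\<exists>p. awalk r p v \<and> length p = i" if "(r, v) \<in> parcs T ^^ i" for i v
    using that
  proof (induction i arbitrary: v)
    case 0
    then show ?case using R.rt_in by (auto simp: awalk_simps)
  next
    case (Suc i)
    then obtain u where "(r, u) \<in> parcs T ^^ i" "(u, v) \<in> parcs T" by auto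
    moreover then obtain p where "awalk r p u" "length p = i" using Suc.IH by blast
    ultimately have "awalk r (p @ [(u, v)]) v" "length (p @ [(u, v)]) = Suc i"
      by (auto intro: awalk_appendI simp: awalk_simps dest: in_arcsD2)
    then show ?case by blast
  qed
  have "y \<in> (parcs T)\<^sup>* `` {y}" by blast
  then obtain v where v: "v \<in> (parcs T)\<^sup>* `` {y}" "\<And>z. (z, v) \<in> (parcs T)\<inverse> \<Longrightarrow> z \<notin> (parcs T)\<^sup>* `` {y}"
    using wfE_min[OF R.wf_converse] by metis
  obtain i where i: "(y, v) \<in> parcs T ^^ i" using v(1) rtrancl_power by blast
  have rv: "(r, v) \<in> parcs T ^^ (j + i)" using assms(2) i by (auto simp: relpow_add)
  then have "(r, v) \<in> (parcs T)\<^sup>*" using rtrancl_power by blast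
  then have "v \<in> pverts T" using R.desc_in_V R.rt_in by blast
  moreover have "(v, z) \<notin> parcs T" for z
  proof
    assume "(v, z) \<in> parcs T"
    then have "z \<in> (parcs T)\<^sup>* `` {y}" using v(1) by auto
    then show False using v(2) \<open>(v, z) \<in> parcs T\<close> by blast
  qed
  ultimately have leaf: "leaf T v" by (auto simp: leaf_def children_def)
  let ?S = "{length p | p v. leaf T v \<and> awalk r p v}"
  \<comment> \<open>Uniqueness of walks makes the lengths part of the image of a finite vertex set,
    so that \<open>Max\<close> is meaningful.\<close>
  have "?S \<subseteq> (\<lambda>v. length (THE p. awalk r p v)) ` pverts T"
  proof
    fix n assume "n \<in> ?S"
    then obtain p v where pv: "n = length p" "leaf T v" "awalk r p v" by blast
    then have "v \<in> pverts T" by (simp add: leaf_def)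
    then have "(THE p. awalk r p v) = p" using assms(1) pv(3) by (intro the1_equality) (auto simp: rooted_tree_def)
    then show "n \<in> (\<lambda>v. length (THE p. awalk r p v)) ` pverts T" using pv \<open>v \<in> pverts T\<close> by force
  qed
  then have "finite ?S" by (rule finite_subset) simp
  moreover obtain p where "awalk r p v" "length p = j + i" using walk[OF rv] by blast
  then have "j + i \<in> ?S" using leaf by (intro CollectI exI[of _ p] exI[of _ v]) simp
  ultimately have "j + i \<le> tree_height T r" unfolding tree_height_def by (rule Max_ge)
  then show ?thesis by simp
qed

text \<open>Nothing requires the root's \<open>Q\<close> to be an ear, so \<open>P r\<close> serves
  as \<open>Q r\<close>. The internal vertices of all ears below avoid \<open>P r\<close>, as the
  disjointness conditions demand when \<open>z\<close> is the root.\<close>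

lemma (in pear_search) subpear_root_imp_clean_pear_tree:
  assumes full: "full_binary_tree T r" and S: "subpear r a P Q"
  shows "clean_binary_pear_tree G T r P (Q(r := P r))"
proof -
  let ?Q = "Q(r := P r)"
  have bt: "binary_tree T r" and two: "\<And>x. x \<in> pverts T \<Longrightarrow> \<not> leaf T x \<Longrightarrow> card (children T x) = 2"
    using full by (auto simp: full_binary_tree_def)
  have D: "desc r = pverts T" using T.reach T.desc_in_V T.rt_in by blast
  have st: "subtree_verts T x = desc x" if "x \<in> pverts T" for x
  proof -
    have "parcs T \<inter> pverts T \<times> pverts T = parcs T" using T.C_sub by blast
    then show ?thesis using rtrancl_on_restrict_iff[OF that, of _ "parcs T"]
      unfolding subtree_verts_def reachable_def by auto
  qed
  have below: "path_pair (P z) (Q z)" "internal_verts (Q z) \<subseteq> sub a - set (P r)"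
    if "z \<in> pverts T" "z \<noteq> r" for z
    using S that unfolding subpear_def D by simp_all
  have arcs: "ear G (set (P y)) (Q x)"
    "\<And>x'. (y, x') \<in> parcs T \<Longrightarrow> x' \<noteq> x \<Longrightarrow> internal_verts (P x) \<inter> set (Q x') = {}"
    "\<And>x' v. (y, x') \<in> parcs T \<Longrightarrow> x' \<noteq> x \<Longrightarrow> v \<in> pverts T - {r} - (desc x \<union> desc x') \<Longrightarrow>
      internal_verts (Q x) \<inter> set (Q v) = {}"
    if "(y, x) \<in> parcs T" for y x
  proof -
    have "y \<in> pverts T" using that T.C_sub by blast
    then have *: "ear G (set (P y)) (Q x) \<and> (\<forall>x'. (y, x') \<in> parcs T \<longrightarrow> x' \<noteq> x \<longrightarrow>
        internal_verts (P x) \<inter> set (Q x') = {} \<and>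
        (\<forall>v \<in> pverts T - {r} - (desc x \<union> desc x'). internal_verts (Q x) \<inter> set (Q v) = {}))"
      using S that unfolding subpear_def D by (elim conjE) (drule bspec, assumption, simp)
    show "ear G (set (P y)) (Q x)"
    "\<And>x'. (y, x') \<in> parcs T \<Longrightarrow> x' \<noteq> x \<Longrightarrow> internal_verts (P x) \<inter> set (Q x') = {}"
    "\<And>x' v. (y, x') \<in> parcs T \<Longrightarrow> x' \<noteq> x \<Longrightarrow> v \<in> pverts T - {r} - (desc x \<union> desc x') \<Longrightarrow>
      internal_verts (Q x) \<inter> set (Q v) = {}"
      using * by metis+
  qed
  have not_r: "x \<noteq> r" if "(y, x) \<in> parcs T" for y x using that T.no_parent_rt by blast
  have root: "path_pair (P r) (P r)"
    using pear_path_vpath[OF subpear_path[OF S]] subgraph_path_graph[of "P r" "[]" "[]"]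
    by (simp add: path_pair_def)
  have "binary_pear_tree G T r P ?Q"
    unfolding binary_pear_tree_def
  proof (intro conjI)
    show "binary_tree T r" by (rule bt)
    have "path_pair (P x) (?Q x)" if "x \<in> pverts T" for x
      using below(1)[OF that] root by simp
    then show "\<forall>x\<in>pverts T. vpath (P x) (with_proj G) \<and> vpath (?Q x) (with_proj G) \<and>
        2 \<le> vwalk_length (P x) \<and> 2 \<le> vwalk_length (?Q x) \<and>
        subgraph (with_proj (path_graph (P x))) (with_proj (path_graph (?Q x)))"
      unfolding path_pair_def by blast
    show "\<forall>(y, x)\<in>parcs T. ear G (set (P y)) (?Q x) \<and>
        (children T y = {x} \<longrightarrow>
          internal_verts (?Q x) \<inter> (\<Union>z\<in>pverts T - subtree_verts T x. set (?Q z)) = {}) \<and>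
        (\<forall>x'\<in>children T y. x' \<noteq> x \<longrightarrow>
           internal_verts (?Q x) \<inter>
             (\<Union>z\<in>pverts T - (subtree_verts T x \<union> subtree_verts T x'). set (?Q z)) = {} \<and>
           internal_verts (P x) \<inter> set (?Q x') = {})"
    proof (intro ballI, clarify, intro conjI impI ballI)
      fix y x assume yx: "(y, x) \<in> parcs T"
      then have V: "y \<in> pverts T" "x \<in> pverts T" using T.C_sub by auto
      have Qx: "?Q x = Q x" using not_r[OF yx] by simp
      show "ear G (set (P y)) (?Q x)" unfolding Qx by (rule arcs(1)[OF yx])
      have nl: "\<not> leaf T y" using yx by (auto simp: leaf_def children_def)
      \<comment> \<open>A full tree has no vertex with exactly one child, so this case is
        vacuous.\<close>
      show "internal_verts (?Q x) \<inter> (\<Union>z\<in>pverts T - subtree_verts T x. set (?Q z)) = {}"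
        if "children T y = {x}" using two[OF V(1) nl] that by simp
      fix x' assume x': "x' \<in> children T y" "x' \<noteq> x"
      then have yx': "(y, x') \<in> parcs T" by (simp add: children_def)
      then have V': "x' \<in> pverts T" using T.C_sub by auto
      have Qx': "?Q x' = Q x'" using not_r[OF yx'] by simp
      show "internal_verts (P x) \<inter> set (?Q x') = {}" unfolding Qx' by (rule arcs(2)[OF yx yx' x'(2)])
      have "internal_verts (Q x) \<inter> set (?Q z) = {}"
        if z: "z \<in> pverts T - (desc x \<union> desc x')" for z
      proof (cases "z = r")
        case True
        then show ?thesis using below(2)[OF V(2) not_r[OF yx]] by auto
      next
        case False
        then show ?thesis using arcs(3)[OF yx yx' x'(2), of z] z by simp
      qed
      then show "internal_verts (?Q x) \<inter>
             (\<Union>z\<in>pverts T - (subtree_verts T x \<union> subtree_verts T x'). set (?Q z)) = {}"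
        unfolding Qx st[OF V(2)] st[OF V'] by blast
    qed
  qed
  moreover have "\<exists>e\<in>path_ends (P y). \<forall>x\<in>children T y. e \<notin> set (?Q x)"
    if y: "y \<in> pverts T" "\<not> leaf T y" for y
  proof -
    have "children T y \<noteq> {}" using y by (auto simp: leaf_def)
    then obtain e where e: "e \<in> path_ends (P y)" "\<forall>z \<in> children T y. e \<notin> set (Q z)"
      using subpear_clean[OF S, of y] y(1) D by auto
    moreover have "\<forall>z \<in> children T y. z \<noteq> r" using not_r by (auto simp: children_def)
    ultimately show ?thesis by auto
  qed
  ultimately show ?thesis unfolding clean_binary_pear_tree_def by blast
qed

theorem theorem5p1:
  fixes l k :: nat
    and G :: "'a pair_pre_digraph"
    and T1 :: "'t pair_pre_digraph"
    and r :: 't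
  assumes "1 \<le> l"
    and "9 * l\<^sup>2 - 3 * l + 1 \<le> k"
    and "minor_minimal_2conn_subdiv_Gamma k G"
    and "full_binary_tree T1 r"
    and "tree_height T1 r \<le> 3 * l - 2"
  shows "minor_of (Gamma_plus l) G \<or> (\<exists>P Q. clean_binary_pear_tree G T1 r P Q)"
proof (rule disjCI)
  assume nopear: "\<not> (\<exists>P Q. clean_binary_pear_tree G T1 r P Q)"
  show "minor_of (Gamma_plus l) G"
  proof (rule ccontr)
    assume nomin: "\<not> minor_of (Gamma_plus l) G"
    \<comment> \<open>With \<open>l = Suc j\<close> the truncated subtractions disappear; the height
      consumed by the recursion is \<open>6 * l\<^sup>2 - l - 2\<close>.\<close>
    obtain j where j: "l = Suc j" using assms(1) by (cases l) auto
    have bound: "(2 * l + 1) * (3 * l - 2) \<le> k - 2" "2 \<le> k"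
      using assms(2) unfolding j by (auto simp: power2_eq_square algebra_simps)
    then have "1 \<le> k" by simp
    then obtain C rt ht where C: "sdtree (pverts G) C rt ht" "ht rt = k" "C \<subseteq> parcs G"
      using minor_minimal_imp_spanning_sdtree[OF assms(3)] by blast
    have tc: "two_connected G" using assms(3) by (simp add: minor_minimal_2conn_subdiv_Gamma_def)
    have rt: "rooted_tree T1 r" using assms(4) by (simp add: full_binary_tree_def binary_tree_def)
    have "spanning_sdtree G C rt ht"
      by (rule spanning_sdtree.intro[OF C(1) spanning_sdtree_axioms.intro[OF tc C(3)]])
    then interpret pear_search G C rt ht T1 r
      by (rule pear_search.intro[OF _ rooted_tree_imp_rtree[OF rt]])
    \<comment> \<open>Two branchings are spent before the recursion. \<open>f\<close> may be the
      root itself, but \<open>p\<close> lies below a child of \<open>f\<close>, so the parent of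
      \<open>a\<close> is not the root. Height \<open>k - 2\<close> remains.\<close>
    have "ht rt = Suc (k - 1)" using C(2) bound(2) by simp
    with rt_in obtain f b c where f: "(rt, f) \<in> C\<^sup>*" "ht f = Suc (k - 1)" "b \<noteq> c" "C `` {f} = {b, c}"
      "ht b = k - 1" "ht c = k - 1" by (rule branch_below)
    have fb: "(f, b) \<in> C" using f(4) by (metis Image_singleton_iff insertCI)
    have "ht b = Suc (k - 2)" using f(5) bound(2) by simp
    with child_in_V(2)[OF fb] obtain p a c' where p: "(b, p) \<in> C\<^sup>*" "ht p = Suc (k - 2)" "a \<noteq> c'"
      "C `` {p} = {a, c'}" "ht a = k - 2" "ht c' = k - 2" by (rule branch_below)
    have pa: "(p, a) \<in> C" using p(4) by (metis Image_singleton_iff insertCI)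
    have "p \<noteq> rt" using p(1) fb no_parent_rt antisym_desc reach child_in_V(2) by blast
    have "\<exists>P Q. subpear r a P Q"
    proof (rule subpear_exists[OF nomin _ T.rt_in _ pa \<open>p \<noteq> rt\<close>])
      show "card (children T1 x) = 2" if "x \<in> pverts T1" "children T1 x \<noteq> {}" for x
        using that assms(4) by (auto simp: full_binary_tree_def leaf_def)
      show "j \<le> 3 * l - 2" if "(r, y) \<in> parcs T1 ^^ j" for j y
        using rooted_tree_height_bound[OF rt that] assms(5) by simp
      show "(2 * l + 1) * (3 * l - 2) \<le> ht a" using bound(1) p(5) by simp
    qed
    then show False
      using subpear_root_imp_clean_pear_tree[OF assms(4)] nopear by blast
  qed
qed

end
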